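(* For every real $\rho\ge 0$ with $\rho\neq\rho_s$, $$|\zeta(1/2+i\rho)|^2=\zeta_I^2+\zeta_R^2=(\zeta'_I\,\zeta_I+\zeta'_R\,\zeta_R)\,f(\rho).$$ Equivalently, on every interval of $\rho\ge0$ on which $\zeta(1/2+i\rho)\neq 0$, any continuous choice $\alpha(\rho)$ of the argument of $\zeta(1/2+i\rho)$ satisfies the differential equation $$\frac{d\alpha(\rho)}{d\rho}=\frac{1}{f(\rho)}.$$
   Context: $\zeta$ is the Riemann zeta function and $\zeta'=d\zeta/ds$ its complex derivative. For real $\rho$ write $\zeta_R=\mathrm{Re}\,\zeta(1/2+i\rho)$, $\zeta_I=\mathrm{Im}\,\zeta(1/2+i\rho)$, $\zeta'_R=\mathrm{Re}\,\zeta'(1/2+i\rho)$, $\zeta'_I=\mathrm{Im}\,\zeta'(1/2+i\rho)$. With $\psi=\Gamma'/\Gamma$ the digamma function, $$f(\rho)=\frac{4\cosh(\pi\rho)}{2\ln(2\pi)\cosh(\pi\rho)-2\,\mathrm{Re}(\psi(1/2+i\rho))\cosh(\pi\rho)+\pi},$$ and $1/f(\rho)$ denotes the reciprocal expression, which is defined for all $\rho$. The point $\rho_s=6.2898\ldots$ is the unique $\rho>0$ at which the denominator of $f$ vanishes (so $1/f(\rho_s)=0$). *)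

theory Defs
  imports "HOL-Complex_Analysis.Complex_Analysis"
begin

(* The Riemann zeta function: the unique analytic continuation to the plane minus {1} of the
   Dirichlet series. The value at the pole is irrelevant; fixing it to 0 makes THE well defined. *)
definition riemann_zeta :: "complex \<Rightarrow> complex" where
  "riemann_zeta = (THE z. z holomorphic_on (- {1}) \<and>
     (\<forall>s. Re s > 1 \<longrightarrow> (\<lambda>n. 1 / (of_nat (Suc n) powr s)) sums z s) \<and> z 1 = 0)"

definition crit :: "real \<Rightarrow> complex" where
  "crit \<rho> = 1 / 2 + \<i> * complex_of_real \<rho>"

definition zeta_R :: "real \<Rightarrow> real" where
  "zeta_R \<rho> = Re (riemann_zeta (crit \<rho>))"

definition zeta_I :: "real \<Rightarrow> real" where
  "zeta_I \<rho> = Im (riemann_zeta (crit \<rho>))"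

definition zeta'_R :: "real \<Rightarrow> real" where
  "zeta'_R \<rho> = Re (deriv riemann_zeta (crit \<rho>))"

definition zeta'_I :: "real \<Rightarrow> real" where
  "zeta'_I \<rho> = Im (deriv riemann_zeta (crit \<rho>))"

definition f_denom :: "real \<Rightarrow> real" where
  "f_denom \<rho> = 2 * ln (2 * pi) * cosh (pi * \<rho>)
     - 2 * Re (Digamma (crit \<rho>)) * cosh (pi * \<rho>) + pi"

definition f_rho :: "real \<Rightarrow> real" where
  "f_rho \<rho> = 4 * cosh (pi * \<rho>) / f_denom \<rho>"

(* The reciprocal of f as an expression in its own right, so that its value at the zero of
   the denominator of f does not rest on the convention x / 0 = 0. *)
definition f_recip :: "real \<Rightarrow> real" where
  "f_recip \<rho> = f_denom \<rho> / (4 * cosh (pi * \<rho>))"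

(* rho_s = 6.2898... *)
definition rho_s :: real where
  "rho_s = (THE \<rho>. \<rho> > 0 \<and> f_denom \<rho> = 0)"

end

theory Submission
  imports Defs
begin

text \<open>
  On the critical line $1 - s$ is the conjugate of $s$, so the functional equation
  $\zeta(s) = \chi(s)\,\zeta(1-s)$ reads $\zeta = \chi\,\overline{\zeta}$ there; differentiating it
  yields $2\,\mathrm{Re}(\zeta'\,\overline{\zeta}) = (\chi'/\chi)\,|\zeta|^2$, and $\chi'/\chi = 2/f$.
  Both claims are this identity. The denominator of $f$ divided by $\cosh(\pi\rho)$ is strictly
  decreasing for $\rho \ge 0$, because the real part of the digamma function increases along the
  critical line.

  For $-1 < s < 0$ real, $\zeta(s)$ is the sum over $n \ge 0$ of the errors of the trapezoidal rule for
  $\int_n^{n+1} u^{-s}\,du$. Each error, multiplied by $\Gamma(s)$, is the integral of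
  $x^{s-1} e^{-nx} ((1 + e^{-x})/2 - (1 - e^{-x})/x)$ over $x > 0$. All terms have the same sign, so the sum over
  $n$ may be taken inside, giving $\frac12\coth(x/2) - 1/x$ as the kernel. The partial fraction expansion
  $\sum_m 2x/(x^2 + 4\pi^2m^2)$ of this kernel, integrated termwise, gives the functional equation
  on the interval, hence everywhere by the identity theorem.
\<close>

section \<open>Mellin transforms of the trapezoidal errors\<close>

text \<open>
  The exponent $-s$ is positive where this is used, so that $0^{-s} = 0$ and the convention
  for \<^term>\<open>0 powr x\<close> makes the term $n = 0$ correct.
\<close>

definition trap_real :: "nat \<Rightarrow> real \<Rightarrow> real" where
  "trap_real n s = (real n powr (-s) + (real n + 1) powr (-s)) / 2
        - ((real n + 1) powr (1 - s) - real n powr (1 - s)) / (1 - s)"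

text \<open>Euler's integral for the Gamma function after the substitution x -> u x. It is stated
  for nonnegative integrals in \<open>ennreal\<close>, so that Tonelli's theorem and termwise
  integration apply without integrability arguments.\<close>

lemma nn_integral_power_exp:
  fixes a u :: real
  assumes "a > 0" "u > 0"
  shows "(\<integral>\<^sup>+x. ennreal (indicator {0<..} x * (x powr (a - 1) * exp (- (u * x)))) \<partial>lborel)
           = ennreal (Gamma a * u powr (- a))"
proof -
  have "ennreal (Gamma a * u powr (- a)) = ennreal (u powr (- a)) *
      (\<integral>\<^sup>+x. ennreal (indicator {0..} x * x powr (a - 1) / exp x) \<partial>lborel)"
    using assms Gamma_conv_nn_integral_real[of a] Gamma_real_pos[of a]
    by (simp add: mult.commute ennreal_mult)
  also have "(\<integral>\<^sup>+x. ennreal (indicator {0..} x * x powr (a - 1) / exp x) \<partial>lborel) =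
     ennreal u * (\<integral>\<^sup>+x. ennreal (indicator {0..} (0 + u * x) * (0 + u * x) powr (a - 1) / exp (0 + u * x)) \<partial>lborel)"
    using assms by (subst nn_integral_real_affine[where c = u and t = 0]) auto
  also have "ennreal (u powr (- a)) * \<dots> = ennreal (u powr (1 - a)) *
      (\<integral>\<^sup>+x. ennreal (indicator {0..} (0 + u * x) * (0 + u * x) powr (a - 1) / exp (0 + u * x)) \<partial>lborel)"
    using assms by (simp add: mult.assoc [symmetric] ennreal_mult [symmetric] powr_diff powr_minus field_simps)
  \<comment> \<open>The indicators of \<open>{0..}\<close> and \<open>{0<..}\<close> can be
    exchanged: at x = 0 the integrand is 0 because \<open>0 powr _ = 0\<close>.\<close>
  also have "\<dots> = (\<integral>\<^sup>+x. ennreal (indicator {0<..} x * (x powr (a - 1) * exp (- (u * x)))) \<partial>lborel)"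
    using assms
    by (subst nn_integral_cmult [symmetric])
       (auto intro!: nn_integral_cong simp: ennreal_mult [symmetric] powr_mult powr_diff exp_minus
              indicator_def zero_le_mult_iff field_simps)
  finally show ?thesis ..
qed

text \<open>The Peano kernel k(u) = (u - n)(n + 1 - u)/2 represents the trapezoidal error of g on
  [n, n + 1] as the integral of k g''. Here g(u) = exp(-ux), and the factor x^2 of g'' is divided
  out on the right.\<close>

lemma nn_integral_kernel_exp:
  fixes x :: real
  assumes "x > 0"
  shows "(\<integral>\<^sup>+u. ennreal ((u - real n) * (real n + 1 - u) / 2 * exp (- (u * x)))
            * indicator {real n..real n + 1} u \<partial>lborel)
          = ennreal (exp (- (real n * x)) * ((1 + exp (- x)) / 2 - (1 - exp (- x)) / x) / x\<^sup>2)"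
proof -
  \<comment> \<open>Repeated integration by parts: the bracket is k/x + k'/x^2 + k''/x^3 with k'' =
    -1.\<close>
  define F where "F = (\<lambda>u. - (exp (- (u * x)) *
      (((u - real n) * (real n + 1 - u) / 2) / x + (real n + 1/2 - u) / x\<^sup>2 - 1 / x ^ 3)))"
  have "((\<lambda>u. (u - real n) * (real n + 1 - u) / 2 * exp (- (u * x))) has_integral
          (F (real n + 1) - F (real n))) {real n..real n + 1}"
  proof (rule fundamental_theorem_of_calculus)
    fix u :: real
    have "(F has_real_derivative (u - real n) * (real n + 1 - u) / 2 * exp (- (u * x))) (at u)"
      unfolding F_def using assms
      by (auto intro!: derivative_eq_intros simp: field_simps power2_eq_square power3_eq_cube)
    thus "(F has_vector_derivative (u - real n) * (real n + 1 - u) / 2 * exp (- (u * x)))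
            (at u within {real n..real n + 1})"
      by (simp add: has_real_derivative_iff_has_vector_derivative has_vector_derivative_at_within)
  qed simp
  hence "(\<integral>\<^sup>+u. ennreal ((u - real n) * (real n + 1 - u) / 2 * exp (- (u * x)))
            * indicator {real n..real n + 1} u \<partial>lborel) = ennreal (F (real n + 1) - F (real n))"
    by (intro nn_integral_has_integral_lebesgue') auto
  also have "F (real n + 1) - F (real n) =
      exp (- (real n * x)) * ((1 + exp (- x)) / 2 - (1 - exp (- x)) / x) / x\<^sup>2"
    unfolding F_def using assms
    by (simp add: field_simps power2_eq_square power3_eq_cube exp_add exp_minus exp_diff)
  finally show ?thesis .
qed

text \<open>The same Peano kernel with g(u) = u^(-s), where g'' = s(s + 1) u^(-s-2). The integrand
  is nonnegative, so all errors have the sign of s(s + 1); this permits the later exchange of sum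
  and integral.\<close>

lemma nn_integral_kernel_powr:
  fixes s :: real
  assumes s: "-1 < s" "s < 0"
  shows "(\<integral>\<^sup>+u. ennreal ((u - real n) * (real n + 1 - u) / 2 * u powr (- s - 2))
            * indicator {real n..real n + 1} u \<partial>lborel) = ennreal (trap_real n s / (s * (s + 1)))"
    and "trap_real n s / (s * (s + 1)) \<ge> 0"
proof -
  let ?f = "\<lambda>u. (u - real n) * (real n + 1 - u) / 2 * u powr (- s - 2)"
  define F where "F = (\<lambda>u. (- (u powr (1 - s)) / (1 - s) - (2 * real n + 1) * u powr (-s) / s
      + real n * (real n + 1) * u powr (- s - 1) / (s + 1)) / 2)"
  \<comment> \<open>For n = 0 the integrand is unbounded at 0, hence the fundamental theorem with
    derivatives in the interior only. The term of \<open>F\<close> with exponent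
    \<open>- s - 1\<close> then has coefficient 0, and the remaining exponents are positive.\<close>
  have cont: "continuous_on {real n..real n + 1} F"
  proof (cases "n = 0")
    case True
    have "continuous_on {0..1} (\<lambda>u. (- (u powr (1 - s)) / (1 - s) - u powr (-s) / s) / 2)"
      using s by (intro continuous_intros continuous_on_powr') auto
    then show ?thesis using True by (simp add: F_def)
  next
    case False
    then show ?thesis unfolding F_def using s
      by (auto intro!: continuous_intros)
  qed
  have "(?f has_integral (F (real n + 1) - F (real n))) {real n..real n + 1}"
  proof (rule fundamental_theorem_of_calculus_interior)
    fix u assume "u \<in> {real n<..<real n + 1}"
    hence u: "u > 0" by auto
    have e: "u powr (-s) = u\<^sup>2 * u powr (- s - 2)" "u powr (-s-1) = u * u powr (- s - 2)"
      using u by (simp_all add: powr_diff powr_minus powr_numeral power2_eq_square field_simps)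
    show "(F has_vector_derivative ?f u) (at u)"
    proof -
      have "(F has_real_derivative
         (- ((1 - s) * u powr (1 - s - 1)) / (1 - s) - (2 * real n + 1) * (-s * u powr (-s - 1)) / s
      + real n * (real n + 1) * ((- s - 1) * u powr (- s - 1 - 1)) / (s + 1)) / 2) (at u)"
        unfolding F_def using u s
        by (intro DERIV_cdivide DERIV_add DERIV_diff DERIV_minus DERIV_cmult has_real_derivative_powr)
      also have "(- ((1 - s) * u powr (1 - s - 1)) / (1 - s) - (2 * real n + 1) * (-s * u powr (-s - 1)) / s
      + real n * (real n + 1) * ((- s - 1) * u powr (- s - 1 - 1)) / (s + 1)) / 2
        = (- (u powr (-s)) + (2 * real n + 1) * u powr (-s - 1) - real n * (real n + 1) * u powr (- s - 2)) / 2"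
      proof -
        have "- s - 1 - 1 = - s - 2" "- 2 - s = - s - 2" "1 - s - 1 = - s" by simp_all
        moreover have "- ((1 - s) * v) / (1 - s) = - v" "m * (- s * v) / s = - (m * v)"
           "m * ((- s - 1) * v) / (s + 1) = - (m * v)" for m v :: real
          using s by (simp_all add: field_simps)
        ultimately show ?thesis by (simp add: minus_diff_commute)
      qed
      also have "\<dots> = ?f u"
        unfolding e by (simp add: field_simps power2_eq_square)
      finally show ?thesis
        by (simp add: has_real_derivative_iff_has_vector_derivative)
    qed
  qed (use cont in auto)
  moreover have "F (real n + 1) - F (real n) = trap_real n s / (s * (s + 1))"
  proof -
    \<comment> \<open>Writing all powers as polynomial multiples of \<open>p\<close> and
      \<open>q\<close> reduces the claim to a rational identity.\<close>
    define p q where "p = (real n + 1) powr (-s - 1)" and "q = (if n = 0 then 0 else real n powr (-s - 1))"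
    have e: "u powr (-s) = u * u powr (- s - 1)" "u powr (1 - s) = u\<^sup>2 * u powr (- s - 1)" if "u > 0" for u
      using that by (simp_all add: powr_diff powr_minus power2_eq_square field_simps)
    have p: "(real n + 1) powr (-s) = (real n + 1) * p" "(real n + 1) powr (1 - s) = (real n + 1)\<^sup>2 * p"
      unfolding p_def by (intro e; simp)+
    have q: "real n powr (-s) = real n * q" "real n powr (1 - s) = (real n)\<^sup>2 * q"
       "real n * (real n + 1) * real n powr (- s - 1) = real n * (real n + 1) * q"
      by (cases "n = 0"; simp add: q_def e)+
    have "F (real n + 1) - F (real n) = 
       (- (real n + 1)\<^sup>2 * p / (1 - s) - (2 * real n + 1) * (real n + 1) * p / s + real n * (real n + 1) * p / (s + 1)
        + (real n)\<^sup>2 * q / (1 - s) + (2 * real n + 1) * real n * q / s - real n * (real n + 1) * q / (s + 1)) / 2"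
      unfolding F_def p q p_def [symmetric] by (simp add: field_simps)
    also have "\<dots> = trap_real n s / (s * (s + 1))"
    proof -
      have [simp]: "s \<noteq> 0" "s + 1 \<noteq> 0" "1 - s \<noteq> 0" "1 + s \<noteq> 0" "s \<noteq> 1" "2 + s * 2 \<noteq> 0" using s by auto
      show ?thesis
      unfolding trap_real_def p q 
       by (simp add: divide_simps) (simp add: algebra_simps power2_eq_square)
    qed
    finally show ?thesis .
  qed
  ultimately have I: "(?f has_integral (trap_real n s / (s * (s + 1)))) {real n..real n + 1}" by simp
  show "trap_real n s / (s * (s + 1)) \<ge> 0" by (rule has_integral_nonneg[OF I]) auto
  show "(\<integral>\<^sup>+u. ennreal (?f u) * indicator {real n..real n + 1} u \<partial>lborel) = ennreal (trap_real n s / (s * (s + 1)))"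
    by (rule nn_integral_has_integral_lebesgue'[OF _ I]) auto
qed

text \<open>Euler's integral replaces Gamma(s+2) u^(-s-2) in the kernel formula, and Tonelli's
  theorem exchanges u and x. The right side is Gamma(s) times the trapezoidal error, since
  Gamma(s+2) = s(s+1) Gamma(s); it is split into two nonnegative factors.\<close>

lemma nn_integral_Mellin_trapezoid:
  fixes s :: real
  assumes s: "-1 < s" "s < 0"
  shows "(\<integral>\<^sup>+x. ennreal (indicator {0<..} x * (x powr (s - 1) * (exp (- (real n * x)) *
            ((1 + exp (- x)) / 2 - (1 - exp (- x)) / x)))) \<partial>lborel)
          = ennreal (Gamma (s + 2) * (trap_real n s / (s * (s + 1))))"
proof -
  let ?k = "\<lambda>u. (u - real n) * (real n + 1 - u) / 2"
  let ?I = "{real n..real n + 1}"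
  have "ennreal (Gamma (s + 2) * (trap_real n s / (s * (s + 1)))) =
      ennreal (Gamma (s + 2)) * (\<integral>\<^sup>+u. ennreal (?k u * u powr (- s - 2)) * indicator ?I u \<partial>lborel)"
    unfolding nn_integral_kernel_powr(1)[OF s, of n]
    using nn_integral_kernel_powr(2)[OF s, of n] Gamma_real_pos[of "s + 2"] s by (intro ennreal_mult) auto
  also have "\<dots> = (\<integral>\<^sup>+u. ennreal (Gamma (s + 2)) * (ennreal (?k u * u powr (- s - 2)) * indicator ?I u) \<partial>lborel)"
    by (rule nn_integral_cmult [symmetric]) measurable
  also have "\<dots> = (\<integral>\<^sup>+u. (\<integral>\<^sup>+x. ennreal (indicator {0<..} x * (x powr (s + 2 - 1) * exp (- (u * x))))
        * (ennreal (?k u) * indicator ?I u) \<partial>lborel) \<partial>lborel)"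
  \<comment> \<open>Euler's integral needs u > 0. The point u = 0, an endpoint of the interval when
    n = 0, is removed as a null set.\<close>
  proof (rule nn_integral_cong_AE, rule AE_mp[OF AE_lborel_singleton[of 0]], intro AE_I2 impI)
    fix u :: real assume "u \<noteq> 0"
    show "ennreal (Gamma (s + 2)) * (ennreal (?k u * u powr (- s - 2)) * indicator ?I u) =
       (\<integral>\<^sup>+x. ennreal (indicator {0<..} x * (x powr (s + 2 - 1) * exp (- (u * x))))
        * (ennreal (?k u) * indicator ?I u) \<partial>lborel)"
    proof (cases "u \<in> ?I")
      case True
      with \<open>u \<noteq> 0\<close> have u: "u > 0" by auto
      have "?k u \<ge> 0" using True by auto
      moreover have "Gamma (s + 2) \<ge> 0" using Gamma_real_pos[of "s + 2"] s by simp
      ultimately show ?thesis using True s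
        by (subst nn_integral_multc, measurable)
           (subst nn_integral_power_exp[OF _ u], auto simp: ennreal_mult [symmetric] mult_ac)
    qed auto
  qed
  also have "\<dots> = (\<integral>\<^sup>+x. (\<integral>\<^sup>+u. ennreal (indicator {0<..} x * (x powr (s + 2 - 1) * exp (- (u * x))))
        * (ennreal (?k u) * indicator ?I u) \<partial>lborel) \<partial>lborel)"
    by (rule lborel_pair.Fubini') measurable
  also have "\<dots> = (\<integral>\<^sup>+x. ennreal (indicator {0<..} x * (x powr (s - 1) * (exp (- (real n * x)) *
            ((1 + exp (- x)) / 2 - (1 - exp (- x)) / x)))) \<partial>lborel)"
  proof (rule nn_integral_cong)
    fix x :: real
    show "(\<integral>\<^sup>+u. ennreal (indicator {0<..} x * (x powr (s + 2 - 1) * exp (- (u * x))))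
        * (ennreal (?k u) * indicator ?I u) \<partial>lborel) =
        ennreal (indicator {0<..} x * (x powr (s - 1) * (exp (- (real n * x)) *
            ((1 + exp (- x)) / 2 - (1 - exp (- x)) / x))))"
    proof (cases "x > 0")
      case True
      have "(\<integral>\<^sup>+u. ennreal (indicator {0<..} x * (x powr (s + 2 - 1) * exp (- (u * x))))
        * (ennreal (?k u) * indicator ?I u) \<partial>lborel) =
         (\<integral>\<^sup>+u. ennreal (x powr (s + 1)) * (ennreal (?k u * exp (- (u * x))) * indicator ?I u) \<partial>lborel)"
        using True
        by (intro nn_integral_cong) (auto simp: indicator_def ennreal_mult [symmetric] ennreal_mult' [symmetric] mult_ac add_ac)
      also have "\<dots> = ennreal (x powr (s + 1)) * ennreal (exp (- (real n * x)) * ((1 + exp (- x)) / 2 - (1 - exp (- x)) / x) / x\<^sup>2)"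
        by (subst nn_integral_cmult, measurable) (subst nn_integral_kernel_exp[OF True], simp)
      also have "\<dots> = ennreal (x powr (s + 1) * (exp (- (real n * x)) * ((1 + exp (- x)) / 2 - (1 - exp (- x)) / x) / x\<^sup>2))"
        by (rule ennreal_mult'[symmetric]) simp
      also have "x powr (s + 1) = x powr (s - 1) * x\<^sup>2"
        using True by (simp add: powr_add powr_diff power2_eq_square)
      finally show ?thesis using True by (simp add: mult_ac)
    qed simp
  qed
  finally show ?thesis ..
qed

text \<open>Writing 1/(x^2 + c^2) as the integral of exp(-(x^2 + c^2) y) over y > 0 and integrating
  over x first leaves two Gamma integrals, at a = (1 + s)/2 and at 1 - a.\<close>

lemma nn_integral_Mellin_quadratic:
  fixes s c :: real
  assumes s: "-1 < s" "s < 1" and c: "c > 0"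
  shows "(\<integral>\<^sup>+x. ennreal (indicator {0<..} x * (x powr (s - 1) * (2 * x / (x\<^sup>2 + c\<^sup>2)))) \<partial>lborel)
          = ennreal (c powr (s - 1) * (pi / cos (pi * s / 2)))"
proof -
  define a where "a = (1 + s) / 2"
  have a: "0 < a" "a < 1" "1 - a = (1 - s) / 2" using s by (auto simp: a_def field_simps)
  \<comment> \<open>Euler's integral for Gamma(a) under the substitution x -> x^2.\<close>
  have gauss: "(\<integral>\<^sup>+x. ennreal (indicator {0<..} x * (2 * x powr s * exp (- (y * x\<^sup>2)))) \<partial>lborel)
      = ennreal (Gamma a * y powr (- a))" if y: "y > 0" for y
  proof -
    have nn: "Gamma a * y powr (- a) \<ge> 0" using Gamma_real_pos[of a] a by simp
    let ?f = "\<lambda>x. x powr (a - 1) * exp (- (y * x))"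
    have "((\<lambda>x. indicator {0<..} x * ?f x) has_integral (Gamma a * y powr (- a))) UNIV"
      by (rule nn_integral_has_integral[OF _ _ nn_integral_power_exp nn]) (use a y in auto)
    hence I: "(?f has_integral (Gamma a * y powr (- a))) {0<..}"
      by (subst has_integral_restrict_UNIV [symmetric], elim has_integral_eq[rotated])
         (auto simp: indicator_def)
    have im: "(\<lambda>x::real. x\<^sup>2) ` {0<..} = {0<..}"
    proof safe
      fix x :: real assume "x > 0"
      thus "x \<in> (\<lambda>x. x\<^sup>2) ` {0<..}" by (intro image_eqI[of _ _ "sqrt x"]) auto
    qed auto
    have "?f absolutely_integrable_on (\<lambda>x::real. x\<^sup>2) ` {0<..} \<and>
        integral ((\<lambda>x::real. x\<^sup>2) ` {0<..}) ?f = Gamma a * y powr (- a)"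
      unfolding im using I
      by (auto intro!: nonnegative_absolutely_integrable_1 simp: has_integral_iff)
    hence "(\<lambda>x. \<bar>2 * x\<bar> * ?f (x\<^sup>2)) absolutely_integrable_on {0<..} \<and>
           integral {0<..} (\<lambda>x. \<bar>2 * x\<bar> * ?f (x\<^sup>2)) = Gamma a * y powr (- a)"
      by (subst has_absolute_integral_change_of_variables_1')
         (auto intro!: derivative_eq_intros inj_onI)
    hence "((\<lambda>x. \<bar>2 * x\<bar> * ?f (x\<^sup>2)) has_integral (Gamma a * y powr (- a))) {0<..}"
      using absolutely_integrable_on_def has_integral_iff by blast
    also have "?this \<longleftrightarrow> ((\<lambda>x. 2 * x powr s * exp (- (y * x\<^sup>2))) has_integral (Gamma a * y powr (- a))) {0<..}"
    proof (rule has_integral_cong)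
      fix x :: real assume "x \<in> {0<..}"
      hence x: "x > 0" by simp
      have "x\<^sup>2 powr (a - 1) = x powr (2 * (a - 1))"
        using x by (simp add: powr_powr flip: powr_numeral)
      also have "2 * (a - 1) = s - 1" by (simp add: a_def field_simps)
      finally show "\<bar>2 * x\<bar> * ?f (x\<^sup>2) = 2 * x powr s * exp (- (y * x\<^sup>2))"
        using x by (simp add: powr_diff)
    qed
    finally show ?thesis
      by (intro nn_integral_has_integral_lebesgue) auto
  qed
  have cp: "(c\<^sup>2) powr (a - 1) = c powr (s - 1)"
  proof -
    have "c\<^sup>2 powr (a - 1) = c powr (2 * (a - 1))"
      using c by (simp add: powr_powr flip: powr_numeral)
    also have "2 * (a - 1) = s - 1" by (simp add: a_def field_simps)
    finally show ?thesis .
  qed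
  \<comment> \<open>The factor \<open>y powr (1 - 1)\<close> puts the inner integral into the form
    of \<open>nn_integral_power_exp\<close> with exponent parameter 1.\<close>
  have "(\<integral>\<^sup>+x. ennreal (indicator {0<..} x * (x powr (s - 1) * (2 * x / (x\<^sup>2 + c\<^sup>2)))) \<partial>lborel) =
     (\<integral>\<^sup>+x. (\<integral>\<^sup>+y. ennreal (indicator {0<..} x * (2 * x powr s)) *
         ennreal (indicator {0<..} y * (y powr (1 - 1) * exp (- ((x\<^sup>2 + c\<^sup>2) * y)))) \<partial>lborel) \<partial>lborel)"
  proof (rule nn_integral_cong)
    fix x :: real
    have p: "x\<^sup>2 + c\<^sup>2 > 0" using c by (simp add: add_nonneg_pos)
    show "ennreal (indicator {0<..} x * (x powr (s - 1) * (2 * x / (x\<^sup>2 + c\<^sup>2)))) =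
      (\<integral>\<^sup>+y. ennreal (indicator {0<..} x * (2 * x powr s)) *
         ennreal (indicator {0<..} y * (y powr (1 - 1) * exp (- ((x\<^sup>2 + c\<^sup>2) * y)))) \<partial>lborel)"
    proof (subst nn_integral_cmult, measurable, subst nn_integral_power_exp[OF _ p], simp)
      have "x powr (s - 1) * (2 * x / (x\<^sup>2 + c\<^sup>2)) = 2 * x powr s * (x\<^sup>2 + c\<^sup>2) powr (- 1)" if "x > 0"
        using that p by (simp add: powr_diff powr_minus divide_inverse)
      thus "ennreal (indicator {0<..} x * (x powr (s - 1) * (2 * x / (x\<^sup>2 + c\<^sup>2)))) =
        ennreal (indicator {0<..} x * (2 * x powr s)) * ennreal (Gamma 1 * (x\<^sup>2 + c\<^sup>2) powr - 1)"
        by (auto simp: indicator_def ennreal_mult [symmetric])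
    qed
  qed
  also have "\<dots> = (\<integral>\<^sup>+y. (\<integral>\<^sup>+x. ennreal (indicator {0<..} x * (2 * x powr s)) *
         ennreal (indicator {0<..} y * (y powr (1 - 1) * exp (- ((x\<^sup>2 + c\<^sup>2) * y)))) \<partial>lborel) \<partial>lborel)"
    by (rule lborel_pair.Fubini'[symmetric]) measurable
  also have "\<dots> = (\<integral>\<^sup>+y. ennreal (Gamma a) * ennreal (indicator {0<..} y * (y powr (1 - a - 1) * exp (- (c\<^sup>2 * y)))) \<partial>lborel)"
  proof (rule nn_integral_cong)
    fix y :: real
    show "(\<integral>\<^sup>+x. ennreal (indicator {0<..} x * (2 * x powr s)) *
         ennreal (indicator {0<..} y * (y powr (1 - 1) * exp (- ((x\<^sup>2 + c\<^sup>2) * y)))) \<partial>lborel) =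
       ennreal (Gamma a) * ennreal (indicator {0<..} y * (y powr (1 - a - 1) * exp (- (c\<^sup>2 * y))))"
    proof (cases "y > 0")
      case True
      have "(\<integral>\<^sup>+x. ennreal (indicator {0<..} x * (2 * x powr s)) *
         ennreal (indicator {0<..} y * (y powr (1 - 1) * exp (- ((x\<^sup>2 + c\<^sup>2) * y)))) \<partial>lborel) =
         (\<integral>\<^sup>+x. ennreal (exp (- (c\<^sup>2 * y))) * ennreal (indicator {0<..} x * (2 * x powr s * exp (- (y * x\<^sup>2)))) \<partial>lborel)"
        using True
        by (intro nn_integral_cong)
           (auto simp: indicator_def ennreal_mult [symmetric] exp_add [symmetric] algebra_simps exp_diff exp_minus divide_simps)
      also have "\<dots> = ennreal (exp (- (c\<^sup>2 * y))) * ennreal (Gamma a * y powr (- a))"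
        by (subst nn_integral_cmult, measurable) (subst gauss[OF True], simp)
      also have "\<dots> = ennreal (Gamma a) * ennreal (indicator {0<..} y * (y powr (1 - a - 1) * exp (- (c\<^sup>2 * y))))"
        using True Gamma_real_pos[OF a(1)] by (simp add: ennreal_mult [symmetric] mult_ac)
      finally show ?thesis .
    qed simp
  qed
  also have "\<dots> = ennreal (Gamma a) * ennreal (Gamma (1 - a) * (c\<^sup>2) powr (- (1 - a)))"
    using a c by (subst nn_integral_cmult, measurable) (subst nn_integral_power_exp, auto)
  also have "\<dots> = ennreal (c powr (s - 1) * (Gamma a * Gamma (1 - a)))"
    using Gamma_real_pos[of a] Gamma_real_pos[of "1 - a"] a cp
    by (simp add: ennreal_mult [symmetric] mult_ac)
  \<comment> \<open>The reflection formula, with sin(pi a) = sin(pi/2 + pi s/2) = cos(pi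
    s/2).\<close>
  also have "Gamma a * Gamma (1 - a) = pi / cos (pi * s / 2)"
  proof -
    have "complex_of_real (Gamma a * Gamma (1 - a)) = of_real (pi / sin (pi * a))"
      using Gamma_reflection_complex[of "of_real a"]
      by (simp add: Gamma_complex_of_real Gamma_complex_of_real[of "1 - a", simplified] sin_of_real flip: of_real_mult)
    hence "Gamma a * Gamma (1 - a) = pi / sin (pi * a)" by (simp only: of_real_eq_iff)
    also have "pi * a = pi / 2 + pi * s / 2" by (simp add: a_def field_simps)
    finally show ?thesis by (simp add: sin_add)
  qed
  finally show ?thesis .
qed

section \<open>Partial fractions of the hyperbolic cotangent\<close>

text \<open>Both sides of Gamma(z) Gamma(1-z) = pi / sin(pi z) are differentiated, and the common
  factor is cancelled.\<close>

lemma Digamma_reflection_complex: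
  fixes z :: complex
  assumes "z \<notin> \<int>"
  shows "Digamma z - Digamma (1 - z) = - of_real pi * cos (of_real pi * z) / sin (of_real pi * z)"
proof -
  have z1: "1 - z \<notin> \<int>"
    using assms Ints_diff[of 1 "1 - z"] by auto
  \<comment> \<open>If the sine vanished, the reflection formula would give the value 0 by the
    convention \<open>x / 0 = 0\<close>, whereas \<open>Gamma\<close> takes the value 0 only at
    nonpositive integers.\<close>
  have nz: "sin (of_real pi * z) \<noteq> 0"
    using assms Gamma_reflection_complex[of z] Gamma_eq_zero_iff[of z] Gamma_eq_zero_iff[of "1 - z"] z1 
      nonpos_Ints_Int by fastforce
  have G: "Gamma z * Gamma (1 - z) = of_real pi / sin (of_real pi * z)"
    by (rule Gamma_reflection_complex)
  have n: "z \<notin> \<int>\<^sub>\<le>\<^sub>0" "1 - z \<notin> \<int>\<^sub>\<le>\<^sub>0" using assms z1 nonpos_Ints_Int by auto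
  have "((\<lambda>z. Gamma z * Gamma (1 - z)) has_field_derivative
      Gamma z * Gamma (1 - z) * (Digamma z - Digamma (1 - z))) (at z)"
    using n by (auto intro!: derivative_eq_intros simp: algebra_simps)
  moreover have "((\<lambda>z. Gamma z * Gamma (1 - z)) has_field_derivative
      - of_real pi * of_real pi * cos (of_real pi * z) / (sin (of_real pi * z))\<^sup>2) (at z)"
    unfolding Gamma_reflection_complex using nz
    by (auto intro!: derivative_eq_intros simp: power2_eq_square)
  ultimately have "Gamma z * Gamma (1 - z) * (Digamma z - Digamma (1 - z)) =
    - of_real pi * of_real pi * cos (of_real pi * z) / (sin (of_real pi * z))\<^sup>2"
    by (rule DERIV_unique)
  hence eq: "of_real pi / sin (of_real pi * z) * (Digamma z - Digamma (1 - z)) =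
    of_real pi / sin (of_real pi * z) * (- of_real pi * cos (of_real pi * z) / sin (of_real pi * z))"
    unfolding G by (simp add: power2_eq_square)
  have "of_real pi / sin (of_real pi * z) \<noteq> 0" using nz by simp
  with eq show ?thesis by (rule mult_left_cancel[THEN iffD1, rotated])
qed

text \<open>The sum is coth(x/2)/2 - 1/x. At z = i x/(2 pi) the digamma series expand psi(1+z) -
  psi(1-z), while recurrence and reflection evaluate this difference in closed form; the claim is
  the imaginary part, divided by 2 pi.\<close>

lemma coth_partial_fractions:
  fixes x :: real
  assumes "x > 0"
  shows "(\<lambda>k. 2 * x / (x\<^sup>2 + (2 * pi * real (Suc k))\<^sup>2)) sums
           ((1 + exp (- x)) / (2 * (1 - exp (- x))) - 1 / x)"
proof -
  define y z where "y = x / (2 * pi)" and "z = \<i> * complex_of_real y"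
  have y: "y > 0" using assms by (simp add: y_def)
  have zI: "z \<notin> \<int>" using y by (auto simp: z_def complex_is_Int_iff)
  have z0: "z \<noteq> 0" "1 + z \<noteq> 0" "1 - z \<noteq> 0" using y by (auto simp: z_def complex_eq_iff)
  have nz: "1 + z + of_nat k \<noteq> 0" "1 - z + of_nat k \<noteq> 0" "of_nat k + z \<noteq> 0" "of_nat k - z \<noteq> 0" for k
    using y by (auto simp: z_def complex_eq_iff)
  \<comment> \<open>In the difference of the two digamma series the terms 1/(k+1) and Euler's
    constant cancel.\<close>
  have "(\<lambda>k. (inverse (of_nat (Suc k)) - inverse (1 + z + of_nat k)) -
         (inverse (of_nat (Suc k)) - inverse (1 - z + of_nat k))) sums
         ((Digamma (1 + z) + euler_mascheroni) - (Digamma (1 - z) + euler_mascheroni))"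
    unfolding Digamma_def using z0 by (intro sums_diff) (simp_all only: diff_add_cancel, auto intro!: summable_sums summable_Digamma simp del: of_nat_Suc)
  hence S: "(\<lambda>k. inverse (1 - z + of_nat k) - inverse (1 + z + of_nat k)) sums (Digamma (1 + z) - Digamma (1 - z))"
    by simp
  have t: "inverse (1 - z + of_nat k) - inverse (1 + z + of_nat k) =
        \<i> * of_real (2 * y / ((real (Suc k))\<^sup>2 + y\<^sup>2))" for k
  proof -
    have "inverse (1 - z + of_nat k) - inverse (1 + z + of_nat k) = 2 * z / ((1 - z + of_nat k) * (1 + z + of_nat k))"
      using nz[of k] by (simp add: divide_simps)
    also have "(1 - z + of_nat k) * (1 + z + of_nat k) = of_real ((real (Suc k))\<^sup>2 + y\<^sup>2)"
      by (simp add: z_def complex_eq_iff power2_eq_square algebra_simps)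
    finally show ?thesis by (simp add: z_def)
  qed
  have "Digamma (1 + z) - Digamma (1 - z) = (Digamma z - Digamma (1 - z)) + 1 / z"
    using Digamma_plus1[OF z0(1)] by (simp add: add.commute)
  also have "Digamma z - Digamma (1 - z) = \<i> * of_real (pi * cosh (pi * y) / sinh (pi * y))"
  proof -
    have "of_real pi * z = \<i> * of_real (pi * y)" by (simp add: z_def)
    hence "cos (of_real pi * z) = of_real (cosh (pi * y))" "sin (of_real pi * z) = \<i> * of_real (sinh (pi * y))"
      by (simp_all add: cos_exp_eq sin_exp_eq cosh_field_def sinh_field_def exp_of_real [symmetric] field_simps)
    thus ?thesis unfolding Digamma_reflection_complex[OF zI] using y by (simp add: divide_simps)
  qed
  also have "1 / z = - \<i> / of_real y" using y by (simp add: z_def divide_inverse mult.commute)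
  finally have "Digamma (1 + z) - Digamma (1 - z) = \<i> * of_real (pi * cosh (pi * y) / sinh (pi * y) - 1 / y)"
    by (simp add: algebra_simps)
  from sums_Im[OF S[unfolded t this]] have
    "(\<lambda>k. 2 * y / ((real (Suc k))\<^sup>2 + y\<^sup>2)) sums (pi * cosh (pi * y) / sinh (pi * y) - 1 / y)"
    by simp
  from sums_mult[OF this, of "1 / (2 * pi)"]
  have "(\<lambda>k. 1 / (2 * pi) * (2 * y / ((real (Suc k))\<^sup>2 + y\<^sup>2))) sums 
      (1 / (2 * pi) * (pi * cosh (pi * y) / sinh (pi * y) - 1 / y))" .
  moreover have "1 / (2 * pi) * (2 * y / ((real (Suc k))\<^sup>2 + y\<^sup>2)) = 2 * x / (x\<^sup>2 + (2 * pi * real (Suc k))\<^sup>2)" for k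
  proof -
    have x: "x = 2 * pi * y" by (simp add: y_def)
    have "(real (Suc k))\<^sup>2 + y\<^sup>2 > 0" using y by (simp add: add_pos_pos)
    moreover have "x\<^sup>2 + (2 * pi * real (Suc k))\<^sup>2 = 4 * pi\<^sup>2 * ((real (Suc k))\<^sup>2 + y\<^sup>2)"
      unfolding x by (simp add: power2_eq_square algebra_simps)
    ultimately show ?thesis unfolding x by (simp add: divide_simps power2_eq_square)
  qed
  moreover have "1 / (2 * pi) * (pi * cosh (pi * y) / sinh (pi * y) - 1 / y)
      = (1 + exp (- x)) / (2 * (1 - exp (- x))) - 1 / x"
  proof -
    have "cosh (pi * y) / sinh (pi * y) = (1 + exp (- x)) / (1 - exp (- x))"
    proof -
      have x2: "pi * y = x / 2" by (simp add: y_def)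
      have e: "exp (- x) = exp (- (x / 2)) * exp (- (x / 2))" by (simp add: exp_add [symmetric])
      have "exp (x / 2) > 1" using assms by simp
      hence "exp (x / 2) * exp (x / 2) > 1" by (metis less_1_mult)
      hence "exp (x / 2) * exp (x / 2) \<noteq> 1" by auto
      thus ?thesis unfolding x2 cosh_field_def sinh_field_def e
        by (simp add: exp_minus divide_simps)
    qed
    moreover have "1 / (2 * pi) * (pi * cosh (pi * y) / sinh (pi * y) - 1 / y)
        = cosh (pi * y) / sinh (pi * y) / 2 - 1 / x"
      using y assms by (simp add: y_def right_diff_distrib)
    ultimately show ?thesis by simp
  qed
  ultimately show ?thesis by simp
qed

section \<open>Two expansions of one Mellin integral\<close>

text \<open>Both sides evaluate the integral of x^(s-1) (coth(x/2)/2 - 1/x) over x > 0, by the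
  geometric series in exp(-x) and by partial fractions. The left side will be recognised as Gamma(s)
  zeta(s); the series on the right is zeta(1-s).\<close>

lemma trapezoid_series_eq:
  fixes s :: real
  assumes s: "-1 < s" "s < 0"
  shows "(\<lambda>n. Gamma (s + 2) * (trap_real n s / (s * (s + 1)))) sums
           ((2 * pi) powr (s - 1) * (pi / cos (pi * s / 2)) * (\<Sum>m. real (Suc m) powr (s - 1)))"
proof -
  define h :: "real \<Rightarrow> real" where "h = (\<lambda>x. (1 + exp (- x)) / (2 * (1 - exp (- x))) - 1 / x)"
  define a where "a = (\<lambda>n. Gamma (s + 2) * (trap_real n s / (s * (s + 1))))"
  define b where "b = (\<lambda>m. (2 * pi * real (Suc m)) powr (s - 1) * (pi / cos (pi * s / 2)))"
  have cos: "cos (pi * s / 2) > 0" using s mult_strict_left_mono[of "- 1" s pi] mult_pos_neg[of pi s]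
    by (intro cos_gt_zero_pi) auto
  have a0: "a n \<ge> 0" for n
    unfolding a_def using nn_integral_kernel_powr(2)[OF s, of n] Gamma_real_pos[of "s + 2"] s
    by (intro mult_nonneg_nonneg) auto
  have b0: "b m \<ge> 0" for m using cos by (simp add: b_def)
  have "summable (\<lambda>m. real (Suc m) powr (s - 1))"
    using s by (subst summable_Suc_iff[of "\<lambda>m. real m powr (s - 1)"]) (simp add: summable_real_powr_iff)
  from sums_mult[OF summable_sums[OF this], of "(2 * pi) powr (s - 1) * (pi / cos (pi * s / 2))"]
  have b: "b sums ((2 * pi) powr (s - 1) * (pi / cos (pi * s / 2)) * (\<Sum>m. real (Suc m) powr (s - 1)))"
    by (simp add: b_def powr_mult mult_ac del: of_nat_Suc)
  have h0: "h x \<ge> 0" if "x > 0" for x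
    unfolding h_def by (rule sums_le[OF _ sums_zero coth_partial_fractions[OF that]]) (use that in auto)
  have hq: "(1 + exp (- x)) / 2 - (1 - exp (- x)) / x = (1 - exp (- x)) * h x" if "x > 0" for x
    using that by (simp add: h_def divide_simps) (simp add: algebra_simps)
  have "(\<Sum>n. ennreal (a n)) = (\<Sum>n. \<integral>\<^sup>+x. ennreal (indicator {0<..} x * (x powr (s - 1) * (exp (- (real n * x)) *
            ((1 + exp (- x)) / 2 - (1 - exp (- x)) / x)))) \<partial>lborel)"
    unfolding a_def nn_integral_Mellin_trapezoid[OF s] ..
  also have "\<dots> = (\<integral>\<^sup>+x. (\<Sum>n. ennreal (indicator {0<..} x * (x powr (s - 1) * (exp (- (real n * x)) *
            ((1 + exp (- x)) / 2 - (1 - exp (- x)) / x))))) \<partial>lborel)"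
    by (rule nn_integral_suminf [symmetric]) measurable
  also have "\<dots> = (\<integral>\<^sup>+x. (\<Sum>m. ennreal (indicator {0<..} x * (x powr (s - 1) *
         (2 * x / (x\<^sup>2 + (2 * pi * real (Suc m))\<^sup>2))))) \<partial>lborel)"
  proof (rule nn_integral_cong)
    fix x :: real
    show "(\<Sum>n. ennreal (indicator {0<..} x * (x powr (s - 1) * (exp (- (real n * x)) *
            ((1 + exp (- x)) / 2 - (1 - exp (- x)) / x))))) =
          (\<Sum>m. ennreal (indicator {0<..} x * (x powr (s - 1) *
            (2 * x / (x\<^sup>2 + (2 * pi * real (Suc m))\<^sup>2)))))"
    proof (cases "x > 0")
      case True
      \<comment> \<open>Summing over n cancels the factor 1 - exp(-x) that \<open>hq\<close> splits
        off and leaves \<open>h x\<close>.\<close>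
      have "(\<lambda>n. exp (- x) ^ n) sums (1 / (1 - exp (- x)))" using True by (intro geometric_sums) auto
      from sums_mult[OF this, of "x powr (s - 1) * ((1 - exp (- x)) * h x)"]
      have "(\<lambda>n. x powr (s - 1) * (exp (- (real n * x)) *
            ((1 + exp (- x)) / 2 - (1 - exp (- x)) / x))) sums (x powr (s - 1) * h x)"
        using True unfolding hq[OF True] exp_of_nat_mult [symmetric] by (simp add: mult_ac)
      hence "(\<Sum>n. ennreal (x powr (s - 1) * (exp (- (real n * x)) *
            ((1 + exp (- x)) / 2 - (1 - exp (- x)) / x)))) = ennreal (x powr (s - 1) * h x)"
        using h0[OF True] True by (intro suminf_ennreal_eq) (auto simp: hq)
      moreover have "(\<Sum>m. ennreal (x powr (s - 1) *
            (2 * x / (x\<^sup>2 + (2 * pi * real (Suc m))\<^sup>2)))) = ennreal (x powr (s - 1) * h x)"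
        using True unfolding h_def by (intro suminf_ennreal_eq sums_mult coth_partial_fractions) auto
      ultimately show ?thesis using True by simp
    qed simp
  qed
  also have "\<dots> = (\<Sum>m. ennreal (b m))"
    unfolding b_def using s
    by (subst nn_integral_suminf, measurable) (intro suminf_cong nn_integral_Mellin_quadratic, auto)
  also have "\<dots> = ennreal ((2 * pi) powr (s - 1) * (pi / cos (pi * s / 2)) * (\<Sum>m. real (Suc m) powr (s - 1)))"
    by (rule suminf_ennreal_eq[OF b0 b])
  finally have eq: "(\<Sum>n. ennreal (a n)) = \<dots>" .
  \<comment> \<open>The sum in \<open>ennreal\<close> equals a real number and so is not infinite;
    for nonnegative terms this is convergence.\<close>
  hence sa: "summable a" by (intro summable_suminf_not_top a0) auto
  have "(\<Sum>n. a n) = (2 * pi) powr (s - 1) * (pi / cos (pi * s / 2)) * (\<Sum>m. real (Suc m) powr (s - 1))"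
  proof (subst ennreal_inj [symmetric])
    show "0 \<le> (\<Sum>n. a n)" by (intro suminf_nonneg sa a0)
    show "0 \<le> (2 * pi) powr (s - 1) * (pi / cos (pi * s / 2)) * (\<Sum>m. real (Suc m) powr (s - 1))"
      by (rule sums_le[OF _ sums_zero b]) (rule b0)
    show "ennreal (suminf a) = ennreal ((2 * pi) powr (s - 1) * (pi / cos (pi * s / 2)) *
             (\<Sum>m. real (Suc m) powr (s - 1)))"
      unfolding eq [symmetric] using suminf_ennreal2[OF a0 sa] by simp
  qed
  with summable_sums[OF sa] show ?thesis unfolding a_def by simp
qed

section \<open>Analytic continuation and functional equation\<close>

text \<open>The factor $s - 1$ removes the singularity of the trapezoidal error at $s = 1$.\<close>

definition trap_complex :: "nat \<Rightarrow> complex \<Rightarrow> complex" where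
  "trap_complex n s = (s - 1) * (of_nat n powr (-s) + (of_nat n + 1) powr (-s)) / 2
      + ((of_nat n + 1) powr (1 - s) - of_nat n powr (1 - s))"

text \<open>For Re s > -1 the exponent is below -1, so the errors are summable on a half plane
  reaching beyond the critical strip. The hypothesis on Re s makes u^(-Re s - 2) nonincreasing, so
  that its value at n bounds it on the segment.\<close>

lemma norm_trap_complex_le:
  assumes n: "n > 0" and s: "Re s \<ge> -2"
  shows "norm (trap_complex n s) \<le> norm (s - 1) * norm s * norm (s + 1) * real n powr (- Re s - 2)"
proof -
  define a :: complex where "a = of_nat n"
  define S where "S = closed_segment a (a + 1)"
  define k where "k = (\<lambda>w::complex. (w - a) * (a + 1 - w) / 2)"
  \<comment> \<open>Peano kernel: for \<open>g w = w powr (- s)\<close> with antiderivative \<open>G\<close>, the function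
    \<open>k g' - k' g - G\<close> has derivative \<open>k g''\<close> since \<open>k'' = - 1\<close>, and its increment
    over \<open>[n, n + 1]\<close> is the trapezoidal error.\<close>
  define F where "F = (\<lambda>w. (s - 1) * (k w * (- s * w powr (- s - 1)) - (a + 1/2 - w) * w powr (-s)) + w powr (1 - s))"
  have S: "\<exists>u. real n \<le> u \<and> u \<le> real n + 1 \<and> w = of_real u" if "w \<in> S" for w
  proof -
    from that obtain t where "0 \<le> t" "t \<le> 1" "w = (1 - t) *\<^sub>R a + t *\<^sub>R (a + 1)"
      unfolding S_def closed_segment_def by auto
    thus ?thesis by (intro exI[of _ "real n + t"]) (auto simp: a_def scaleR_conv_of_real algebra_simps)
  qed
  have "norm (F (a + 1) - F a) \<le> norm (s - 1) * norm s * norm (s + 1) * real n powr (- Re s - 2) * norm (a + 1 - a)"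
  proof (rule field_differentiable_bound)
    show "convex S" by (simp add: S_def)
    show "a \<in> S" "a + 1 \<in> S" by (simp_all add: S_def)
    fix w assume "w \<in> S"
    then obtain u where u: "real n \<le> u" "u \<le> real n + 1" "w = of_real u" using S by blast
    have "u > 0" using u n by simp
    hence w: "w \<notin> \<real>\<^sub>\<le>\<^sub>0" "w \<noteq> 0" using u by (auto simp: complex_nonpos_Reals_iff)
    have d: "((\<lambda>w. w powr c) has_field_derivative c * w powr (c - 1)) (at w)" for c
      using w by (intro has_field_derivative_powr)
    have dk: "(k has_field_derivative (a + 1/2 - w)) (at w)"
      unfolding k_def by (auto intro!: derivative_eq_intros simp: field_simps)
    have dk': "((\<lambda>w. a + 1/2 - w) has_field_derivative - 1) (at w)"
      by (auto intro!: derivative_eq_intros)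
    have "(F has_field_derivative
       (s - 1) * (((a + 1/2 - w) * (- s * w powr (- s - 1)) + - s * ((- s - 1) * w powr (- s - 1 - 1)) * k w)
          - (- 1 * w powr (-s) + - s * w powr (- s - 1) * (a + 1/2 - w))) + (1 - s) * w powr (1 - s - 1)) (at w)"
      unfolding F_def by (intro DERIV_add DERIV_cmult DERIV_diff DERIV_mult d dk dk')
    also have "(s - 1) * (((a + 1/2 - w) * (- s * w powr (- s - 1)) + - s * ((- s - 1) * w powr (- s - 1 - 1)) * k w)
          - (- 1 * w powr (-s) + - s * w powr (- s - 1) * (a + 1/2 - w))) + (1 - s) * w powr (1 - s - 1)
        = (s - 1) * s * (s + 1) * k w * w powr (- s - 2)"
    proof -
      have "- s - 1 - 1 = - s - 2" "1 - s - 1 = - s" by simp_all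
      thus ?thesis by (simp only:) (simp add: algebra_simps)
    qed
    finally show "(F has_field_derivative (s - 1) * s * (s + 1) * k w * w powr (- s - 2)) (at w within S)"
      by (rule has_field_derivative_at_within)
    have "k w = of_real ((u - real n) * (real n + 1 - u) / 2)"
      by (simp add: k_def u a_def)
    hence "norm (k w) = \<bar>(u - real n) * (real n + 1 - u) / 2\<bar>" by (metis norm_of_real)
    moreover have "(u - real n) * (real n + 1 - u) \<le> 1 * 1" using u by (intro mult_mono) auto
    moreover have "(u - real n) * (real n + 1 - u) \<ge> 0" using u by auto
    ultimately have k: "norm (k w) \<le> 1" by simp
    have "norm (w powr (- s - 2)) = u powr (- Re s - 2)"
      using u \<open>u > 0\<close> by (simp add: norm_powr_real_powr)
    also have "\<dots> \<le> real n powr (- Re s - 2)"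
      using u n s by (intro powr_mono2') auto
    finally have p: "norm (w powr (- s - 2)) \<le> real n powr (- Re s - 2)" .
    have "norm ((s - 1) * s * (s + 1)) * (norm (k w) * norm (w powr (- s - 2)))
        \<le> norm ((s - 1) * s * (s + 1)) * (1 * real n powr (- Re s - 2))"
      using k p by (intro mult_mono) auto
    thus "norm ((s - 1) * s * (s + 1) * k w * w powr (- s - 2))
        \<le> norm (s - 1) * norm s * norm (s + 1) * real n powr (- Re s - 2)"
      by (simp add: norm_mult mult_ac)
  qed
  moreover have "F (a + 1) - F a = trap_complex n s"
    by (simp add: F_def k_def trap_complex_def a_def field_simps)
  ultimately show ?thesis by simp
qed

text \<open>This is (s - 1) zeta(s), with the pole removed. The summand
  \<open>1 + (s - 1) / 2\<close> is the error for n = 0 with both powers of 0 read as 0; it stands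
  apart because the estimate of the errors requires n > 0.\<close>

definition zeta_num :: "complex \<Rightarrow> complex" where
  "zeta_num s = 1 + (s - 1) / 2 + (\<Sum>n. trap_complex (Suc n) s)"

text \<open>A local Weierstrass majorant, in the form required by the theorem on termwise
  differentiation.\<close>

lemma trap_complex_bound_local:
  assumes "Re x > -1"
  shows "\<exists>d h. 0 < d \<and> summable h \<and> (\<forall>\<^sub>F n in sequentially. \<forall>y\<in>ball x d \<inter> {s. Re s > -1}.
            norm (trap_complex (Suc n) y) \<le> h n)"
proof -
  \<comment> \<open>With \<open>d\<close> half the distance from x to the line Re s = -1, every y in
    the ball has Re y > -1 + d, so the exponent is at most -1 - d. The constant \<open>M\<close>
    bounds |y|, |y - 1| and |y + 1| there.\<close>
  define d where "d = (Re x + 1) / 2"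
  define M where "M = norm x + d + 1"
  define h where "h = (\<lambda>n. M ^ 3 * real (Suc n) powr (- 1 - d))"
  have d: "d > 0" using assms by (simp add: d_def)
  have "summable (\<lambda>n. real (Suc n) powr (- 1 - d))"
    using d by (subst summable_Suc_iff[of "\<lambda>m. real m powr (- 1 - d)"]) (simp add: summable_real_powr_iff)
  hence "summable h" unfolding h_def by (rule summable_mult)
  moreover have "norm (trap_complex (Suc n) y) \<le> h n" if "y \<in> ball x d" for y n
  proof -
    have dist: "norm (y - x) < d" using that by (simp add: dist_norm norm_minus_commute)
    have "\<bar>Re (y - x)\<bar> < d" using dist abs_Re_le_cmod[of "y - x"] by linarith
    hence re: "- Re y - 2 \<le> - 1 - d" unfolding minus_complex.simps d_def by argo
    have ny: "norm y \<le> norm x + d" using dist norm_triangle_ineq2[of y x] by linarith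
    have M: "norm y \<le> M" "norm (y - 1) \<le> M" "norm (y + 1) \<le> M"
      using ny norm_triangle_ineq[of y 1] norm_triangle_ineq4[of y 1] by (auto simp: M_def)
    have "norm (trap_complex (Suc n) y) \<le> norm (y - 1) * norm y * norm (y + 1) * real (Suc n) powr (- Re y - 2)"
      by (rule norm_trap_complex_le) (use re d in auto)
    also have "\<dots> \<le> (M * M * M) * real (Suc n) powr (- 1 - d)"
      using M re d by (intro mult_mono powr_mono) (auto simp: M_def)
    finally show ?thesis by (simp add: h_def power3_eq_cube)
  qed
  ultimately show ?thesis using d by (intro exI[of _ d] exI[of _ h]) auto
qed

lemma zeta_num_holomorphic: "zeta_num holomorphic_on {s. Re s > -1}"
  and trap_complex_summable: "Re s > -1 \<Longrightarrow> summable (\<lambda>n. trap_complex (Suc n) s)"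
proof -
  let ?S = "{s. Re s > -1}"
  have op: "open ?S" by (rule open_halfspace_Re_gt)
  have "\<exists>g g'. \<forall>x\<in>?S. ((\<lambda>n. trap_complex (Suc n) x) sums g x) \<and>
     ((\<lambda>n. deriv (trap_complex (Suc n)) x) sums g' x) \<and> (g has_field_derivative g' x) (at x)"
  proof (rule series_and_derivative_comparison_local[OF op])
    fix n x
    show "(trap_complex (Suc n) has_field_derivative deriv (trap_complex (Suc n)) x) (at x)"
    proof (rule holomorphic_derivI)
      show "trap_complex (Suc n) holomorphic_on UNIV"
        unfolding trap_complex_def by (intro holomorphic_intros) auto
    qed auto
  qed (use trap_complex_bound_local in auto)
  then obtain g g' where g: "\<And>x. Re x > -1 \<Longrightarrow> (\<lambda>n. trap_complex (Suc n) x) sums g x"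
     "\<And>x. Re x > -1 \<Longrightarrow> (g has_field_derivative g' x) (at x)" by auto
  show "Re s > -1 \<Longrightarrow> summable (\<lambda>n. trap_complex (Suc n) s)"
    using g(1) sums_summable by blast
  have "g holomorphic_on ?S"
    using g(2) op by (auto simp: holomorphic_on_open)
  hence "(\<lambda>s. 1 + (s - 1) / 2 + g s) holomorphic_on ?S"
    by (intro holomorphic_intros) auto
  thus "zeta_num holomorphic_on ?S"
    by (rule holomorphic_transform) (use g(1) in \<open>auto simp: zeta_num_def sums_iff\<close>)
qed

text \<open>In a partial sum of the errors each inner power occurs as half of two neighbouring
  trapezoids and the integrals telescope. The boundary terms at N + 1 vanish in the limit for Re s >
  1, which leaves the Dirichlet series.\<close>

lemma zeta_num_sums:
  assumes s: "Re s > 1"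
  shows "(\<lambda>n. 1 / (of_nat (Suc n) powr s)) sums (zeta_num s / (s - 1))"
proof -
  have s1: "s \<noteq> 1" using s by auto
  have part: "(\<Sum>n<N. trap_complex (Suc n) s) = (s - 1) * (\<Sum>n<N. 1 / (of_nat (Suc n) powr s))
       - (s - 1) / 2 - 1 + (s - 1) / 2 * of_nat (Suc N) powr (- s) + of_nat (Suc N) powr (1 - s)" for N
  proof -
    define P where "P = (\<lambda>n. complex_of_nat (Suc n) powr (- s))"
    define Q where "Q = (\<lambda>n. complex_of_nat (Suc n) powr (1 - s))"
    have P: "1 / (of_nat (Suc n) powr s) = P n" for n
      by (simp add: P_def powr_minus divide_inverse del: of_nat_Suc)
    have T: "trap_complex (Suc n) s = (s - 1) * (P n + P (Suc n)) / 2 + (Q (Suc n) - Q n)" for n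
      by (simp add: trap_complex_def P_def Q_def add_ac)
    have [simp]: "P 0 = 1" "Q 0 = 1" by (simp_all add: P_def Q_def)
    have "(\<Sum>n<N. trap_complex (Suc n) s) = (s - 1) * (\<Sum>n<N. P n) - (s - 1) / 2 - 1 + (s - 1) / 2 * P N + Q N"
    proof (induction N)
      case (Suc N)
      show ?case unfolding sum.lessThan_Suc Suc.IH unfolding T by (simp add: field_simps)
    qed simp
    thus ?thesis unfolding P by (simp only: P_def Q_def)
  qed
  have lim0: "(\<lambda>N. of_nat (Suc N) powr c :: complex) \<longlonglongrightarrow> 0" if "Re c < 0" for c
  proof (rule tendsto_norm_zero_cancel)
    have "(\<lambda>N. real N powr Re c) \<longlonglongrightarrow> 0"
      using that by (intro tendsto_neg_powr filterlim_real_sequentially) auto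
    hence "(\<lambda>N. real (Suc N) powr Re c) \<longlonglongrightarrow> 0" by (rule LIMSEQ_Suc)
    moreover have "norm (of_nat (Suc N) powr c :: complex) = real (Suc N) powr Re c" for N
      using norm_powr_real_powr[of "of_nat (Suc N)" c] by (simp del: of_nat_Suc)
    ultimately show "(\<lambda>N. norm (of_nat (Suc N) powr c :: complex)) \<longlonglongrightarrow> 0" by simp
  qed
  have eq: "(\<Sum>n<N. 1 / (of_nat (Suc n) powr s)) = ((\<Sum>n<N. trap_complex (Suc n) s) + (s - 1) / 2 + 1
        - (s - 1) / 2 * of_nat (Suc N) powr (- s) - of_nat (Suc N) powr (1 - s)) / (s - 1)" for N
    unfolding part using s1 by (simp add: field_simps)
  have "(\<lambda>N. ((\<Sum>n<N. trap_complex (Suc n) s) + (s - 1) / 2 + 1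
        - (s - 1) / 2 * of_nat (Suc N) powr (- s) - of_nat (Suc N) powr (1 - s)) / (s - 1))
       \<longlonglongrightarrow> ((\<Sum>n. trap_complex (Suc n) s) + (s - 1) / 2 + 1 - (s - 1) / 2 * 0 - 0) / (s - 1)"
    using s s1 by (intro tendsto_intros summable_LIMSEQ trap_complex_summable lim0) auto
  thus ?thesis unfolding sums_def eq by (simp add: zeta_num_def add_ac)
qed

lemma zeta_num_of_real_sums:
  fixes s :: real
  assumes s: "-1 < s" "s < 0"
  shows "(\<lambda>n. complex_of_real (trap_real n s)) sums (zeta_num (of_real s) / (of_real s - 1))"
proof -
  have s1: "complex_of_real s \<noteq> 1" using s by (simp add: complex_eq_iff)
  have pw: "complex_of_nat n powr of_real r = of_real (real n powr r)"
    "(complex_of_nat n + 1) powr of_real r = of_real ((real n + 1) powr r)" for r n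
    using powr_of_real[of "real n" r] powr_of_real[of "real n + 1" r] by simp_all
  have t: "trap_complex n (of_real s) / (of_real s - 1) = of_real (trap_real n s)" for n
  proof -
    have "trap_complex n (of_real s) = of_real ((s - 1) * trap_real n s)"
      unfolding trap_complex_def trap_real_def
      using pw[of n "- s"] pw[of n "1 - s"] s by (simp add: field_simps)
    thus ?thesis using s1 by simp
  qed
  have "(\<lambda>n. trap_complex (Suc n) (of_real s) / (of_real s - 1)) sums ((\<Sum>n. trap_complex (Suc n) (of_real s)) / (of_real s - 1))"
    using s by (intro sums_divide summable_sums trap_complex_summable) auto
  hence "(\<lambda>n. complex_of_real (trap_real n s)) sums
       ((\<Sum>n. trap_complex (Suc n) (of_real s)) / (of_real s - 1) + of_real (trap_real 0 s))"
    unfolding t by (subst (asm) sums_Suc_iff) simp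
  \<comment> \<open>The error for n = 0, restored by the index shift, is the separate summand of
    \<open>zeta_num\<close> divided by s - 1.\<close>
  also have "complex_of_real (trap_real 0 s) = (1 + (of_real s - 1) / 2) / (of_real s - 1)"
    unfolding trap_real_def using s s1 by (simp add: field_simps)
  finally show ?thesis
    by (simp add: zeta_num_def add_divide_distrib add_ac)
qed

section \<open>Functional equation on the strip -1 < Re s < 0\<close>

text \<open>The factor chi of the asymmetric functional equation zeta(s) = chi(s) zeta(1-s). In this
  form it is free of poles for Re s < 1.\<close>

definition zeta_chi :: "complex \<Rightarrow> complex" where
  "zeta_chi s = 2 * (2 * of_real pi) powr (s - 1) * sin (of_real pi * s / 2) * Gamma (1 - s)"

lemma zeta_chi_holomorphic: "zeta_chi holomorphic_on {s. Re s < 1}"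
  unfolding zeta_chi_def
  by (intro holomorphic_intros) (auto simp: complex_nonpos_Reals_iff elim!: nonpos_Ints_cases dest!: arg_cong[of _ _ Re])

text \<open>\<open>trapezoid_series_eq\<close> relates Gamma(s) zeta(s) to zeta(1-s); multiplying by
  Gamma(1-s) and using the reflection formula isolates zeta(s). Both quotients are instances of
  \<open>zeta_num z / (z - 1)\<close>, at z = s and z = 1 - s.\<close>

lemma zeta_num_functional_real:
  fixes s :: real
  assumes s: "-1 < s" "s < 0"
  shows "zeta_num (of_real s) / (of_real s - 1)
           = zeta_chi (of_real s) * (zeta_num (1 - of_real s) / (1 - of_real s - 1))"
proof -
  define Z where "Z = Re (zeta_num (of_real s) / (of_real s - 1))"
  define D where "D = (\<Sum>m. real (Suc m) powr (s - 1))"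
  define sn cs where "sn = sin (pi * s / 2)" and "cs = cos (pi * s / 2)"
  have lt: "- pi < pi * s" "pi * s < 0"
    using s mult_strict_left_mono[of "- 1" s pi] mult_pos_neg[of pi s] by auto
  have cs: "cs > 0" unfolding cs_def using lt pi_gt_zero by (intro cos_gt_zero_pi) linarith+
  have sn: "sn < 0" unfolding sn_def using lt pi_gt_zero by (intro sin_less_zero) linarith+
  have sin2: "sin (pi * s) = 2 * sn * cs"
    using sin_double[of "pi * s / 2"] by (simp add: sn_def cs_def)
  note S = zeta_num_of_real_sums[OF s]
  have Zs: "(\<lambda>n. trap_real n s) sums Z"
    using sums_Re[OF S] by (simp add: Z_def)
  hence Zc: "zeta_num (of_real s) / (of_real s - 1) = of_real Z"
    using S sums_of_real[OF Zs, where 'a = complex] sums_unique2 by blast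
  have "(\<lambda>n. Gamma (s + 2) * (trap_real n s / (s * (s + 1)))) sums (Gamma (s + 2) * (Z / (s * (s + 1))))"
    by (intro sums_mult sums_divide Zs)
  from sums_unique2[OF this trapezoid_series_eq[OF s]]
  have "Gamma (s + 2) * (Z / (s * (s + 1))) = (2 * pi) powr (s - 1) * (pi / cs) * D"
    by (simp add: D_def cs_def)
  moreover have "Gamma (s + 2) = s * (s + 1) * Gamma s"
  proof -
    have "s \<notin> \<int>\<^sub>\<le>\<^sub>0" using s by (auto elim!: nonpos_Ints_cases)
    moreover have "s + 1 \<notin> \<int>\<^sub>\<le>\<^sub>0" using s nonpos_Ints_nonpos[of "s + 1"] by auto
    ultimately show ?thesis using Gamma_plus1[of s] Gamma_plus1[of "s + 1"] by (simp add: add_ac)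
  qed
  ultimately have E1: "Gamma s * Z = (2 * pi) powr (s - 1) * (pi / cs) * D"
    using s by simp
  have "complex_of_real (Gamma s * Gamma (1 - s)) = of_real (pi / sin (pi * s))"
    using Gamma_reflection_complex[of "of_real s"]
    by (simp add: Gamma_complex_of_real Gamma_complex_of_real[of "1 - s", simplified] sin_of_real flip: of_real_mult)
  hence E2: "Gamma s * Gamma (1 - s) = pi / (2 * sn * cs)"
    unfolding sin2 by (simp only: of_real_eq_iff)
  \<comment> \<open>In pi / sin(pi s) = pi / (2 sn cs) the cosine cancels against that of
    \<open>E1\<close>, and the sine moves to the right.\<close>
  have E3: "Z = 2 * (2 * pi) powr (s - 1) * sn * Gamma (1 - s) * D"
  proof -
    have "pi / (2 * sn * cs) * Z = (2 * pi) powr (s - 1) * (pi / cs) * D * Gamma (1 - s)"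
      unfolding E1 [symmetric] E2 [symmetric] by simp
    thus ?thesis using sn cs by (simp add: field_simps)
  qed
  have "summable (\<lambda>m. real (Suc m) powr (s - 1))"
    using s by (subst summable_Suc_iff[of "\<lambda>m. real m powr (s - 1)"]) (simp add: summable_real_powr_iff)
  hence Ds: "(\<lambda>m. real (Suc m) powr (s - 1)) sums D"
    unfolding D_def by (rule summable_sums)
  have Re1: "Re (1 - complex_of_real s) > 1" using s by simp
  have "(\<lambda>n. complex_of_real (real (Suc n) powr (s - 1))) sums
         (zeta_num (1 - of_real s) / (1 - of_real s - 1))"
  proof (rule sums_cong[THEN iffD1, OF _ zeta_num_sums[OF Re1]])
    fix n
    have "complex_of_real (real (Suc n) powr (s - 1)) = of_nat (Suc n) powr (of_real (s - 1))"
      using powr_of_real[of "real (Suc n)" "s - 1"] by (simp del: of_nat_Suc)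
    also have "\<dots> = 1 / of_nat (Suc n) powr (1 - complex_of_real s)"
      by (simp add: powr_minus [symmetric] divide_inverse del: of_nat_Suc)
    finally show "1 / of_nat (Suc n) powr (1 - complex_of_real s) = complex_of_real (real (Suc n) powr (s - 1))" ..
  qed
  hence "zeta_num (1 - of_real s) / (1 - of_real s - 1) = of_real D"
    by (rule sums_unique2[OF _ sums_of_real[OF Ds]])
  moreover have "zeta_chi (of_real s) = of_real (2 * (2 * pi) powr (s - 1) * sn * Gamma (1 - s))"
  proof -
    have "(2 * complex_of_real pi) powr (of_real s - 1) = of_real ((2 * pi) powr (s - 1))"
      using powr_of_real[of "2 * pi" "s - 1"] by simp
    moreover have "sin (complex_of_real pi * of_real s / 2) = of_real sn"
      unfolding sn_def by (simp flip: sin_of_real)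
    moreover have "Gamma (1 - complex_of_real s) = of_real (Gamma (1 - s))"
      using Gamma_complex_of_real[of "1 - s"] by simp
    ultimately show ?thesis by (simp add: zeta_chi_def)
  qed
  ultimately show ?thesis unfolding Zc E3 by simp
qed

text \<open>Identity theorem on the strip: both sides are holomorphic and agree on the real segment,
  which accumulates at -1/2.\<close>

lemma zeta_num_functional:
  assumes "-1 < Re s" "Re s < 0"
  shows "zeta_num s / (s - 1) = zeta_chi s * (zeta_num (1 - s) / (1 - s - 1))"
proof -
  define S where "S = {s. -1 < Re s} \<inter> {s. Re s < 0}"
  define U where "U = complex_of_real ` {-1<..<0}"
  have "zeta_num s / (s - 1) - zeta_chi s * (zeta_num (1 - s) / (1 - s - 1)) = 0"
  proof (rule analytic_continuation[where S = S and U = U and w = s and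
      f = "\<lambda>s. zeta_num s / (s - 1) - zeta_chi s * (zeta_num (1 - s) / (1 - s - 1))"])
    show "(\<lambda>s. zeta_num s / (s - 1) - zeta_chi s * (zeta_num (1 - s) / (1 - s - 1))) holomorphic_on S"
      unfolding S_def
      by (intro holomorphic_intros holomorphic_on_compose_gen[OF _ zeta_num_holomorphic, unfolded o_def]
            holomorphic_on_subset[OF zeta_num_holomorphic] holomorphic_on_subset[OF zeta_chi_holomorphic])
         auto
    show "open S" unfolding S_def by (intro open_Int open_halfspace_Re_gt open_halfspace_Re_lt)
    show "connected S" unfolding S_def
      by (intro convex_connected convex_Int convex_halfspace_Re_gt convex_halfspace_Re_lt)
    show "U \<subseteq> S" by (auto simp: U_def S_def)
    show "complex_of_real (-1/2) \<in> S" by (simp add: S_def)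
    show "complex_of_real (-1/2) islimpt U"
      unfolding U_def
    proof (rule islimpt_isCont_image)
      show "(- 1 / 2 :: real) islimpt {- 1<..<0}" by (rule interior_limit_point) simp
      show "\<forall>\<^sub>F y in at (- 1 / 2). complex_of_real y \<noteq> complex_of_real (- 1 / 2)"
        unfolding of_real_eq_iff eventually_at_filter by simp
    qed simp
    show "s \<in> S" using assms by (simp add: S_def)
  qed (auto simp: U_def zeta_num_functional_real)
  thus ?thesis by (rule eq_iff_diff_eq_0[THEN iffD2])
qed

section \<open>Continuation to the punctured plane and identification with zeta\<close>

text \<open>Two formulas glued along the strip -1 < Re s < 0, where they agree by the functional
  equation. The value at 1 is the one prescribed for \<open>riemann_zeta\<close>.\<close>

definition zeta_ext :: "complex \<Rightarrow> complex" where
  "zeta_ext s = (if s \<in> {s. Re s > -1} - {1} then zeta_num s / (s - 1)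
     else if s = 1 then 0 else zeta_chi s * (zeta_num (1 - s) / (1 - s - 1)))"

lemma zeta_ext_left: "Re s < 0 \<Longrightarrow> zeta_ext s = zeta_chi s * (zeta_num (1 - s) / (1 - s - 1))"
  unfolding zeta_ext_def using zeta_num_functional[of s] by auto

lemma zeta_ext_holomorphic: "zeta_ext holomorphic_on (- {1})"
proof -
  have 1: "zeta_ext holomorphic_on ({s. Re s > -1} - {1})"
  proof (rule holomorphic_transform)
    show "(\<lambda>s. zeta_num s / (s - 1)) holomorphic_on ({s. Re s > -1} - {1})"
      by (intro holomorphic_intros holomorphic_on_subset[OF zeta_num_holomorphic]) auto
  qed (simp add: zeta_ext_def)
  have 2: "zeta_ext holomorphic_on {s. Re s < 0}"
  proof (rule holomorphic_transform)
    show "(\<lambda>s. zeta_chi s * (zeta_num (1 - s) / (1 - s - 1))) holomorphic_on {s. Re s < 0}"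
      by (intro holomorphic_intros holomorphic_on_compose_gen[OF _ zeta_num_holomorphic, unfolded o_def]
           holomorphic_on_subset[OF zeta_chi_holomorphic]) auto
  qed (simp add: zeta_ext_left)
  have "zeta_ext holomorphic_on (({s. Re s > -1} - {1}) \<union> {s. Re s < 0})"
    by (intro holomorphic_on_Un 1 2 open_Diff open_halfspace_Re_gt open_halfspace_Re_lt) auto
  also have "({s. Re s > -1} - {1}) \<union> {s. Re s < 0} = - {1}" by auto
  finally show ?thesis .
qed

text \<open>The identity theorem on the connected punctured plane. It serves both to evaluate the
  \<open>THE\<close> in \<open>riemann_zeta\<close> and to prove the conjugation symmetry.\<close>

lemma zeta_continuation_unique:
  assumes "z holomorphic_on (- {1})" "w holomorphic_on (- {1})"
    and "\<And>s. Re s > 1 \<Longrightarrow> z s = w s" and "z 1 = w 1"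
  shows "z = w"
proof
  fix s
  show "z s = w s"
  proof (cases "s = 1")
    case False
    show ?thesis
    proof (rule analytic_continuation_open[where f = z and g = w and z = s and
          s = "{s. Re s > 1}" and s' = "- {1}"])
      have "(2::complex) \<in> {s. Re s > 1}" by simp
      thus "{s. Re s > 1} \<noteq> ({} :: complex set)" by blast
      show "connected (- {1 :: complex})" by (intro connected_punctured_universe) simp
    qed (use assms False in \<open>auto simp: open_halfspace_Re_gt\<close>)
  qed (use assms in simp)
qed

lemma zeta_ext_sums: "Re s > 1 \<Longrightarrow> (\<lambda>n. 1 / (of_nat (Suc n) powr s)) sums zeta_ext s"
  using zeta_num_sums[of s] by (auto simp: zeta_ext_def)

lemma riemann_zeta_eq_zeta_ext: "riemann_zeta = zeta_ext"
  unfolding riemann_zeta_def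
proof (rule the_equality)
  show "zeta_ext holomorphic_on - {1} \<and> (\<forall>s. 1 < Re s \<longrightarrow> (\<lambda>n. 1 / of_nat (Suc n) powr s) sums zeta_ext s) \<and> zeta_ext 1 = 0"
    using zeta_ext_holomorphic zeta_ext_sums by (simp add: zeta_ext_def)
next
  fix z assume z: "z holomorphic_on - {1} \<and> (\<forall>s. 1 < Re s \<longrightarrow> (\<lambda>n. 1 / of_nat (Suc n) powr s) sums z s) \<and> z 1 = 0"
  show "z = zeta_ext"
  proof (rule zeta_continuation_unique)
    show "z s = zeta_ext s" if "Re s > 1" for s
      using z zeta_ext_sums[OF that] that sums_unique2 by blast
  qed (use z zeta_ext_holomorphic in \<open>auto simp: zeta_ext_def\<close>)
qed

lemma riemann_zeta_holomorphic: "riemann_zeta holomorphic_on (- {1})"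
  by (simp add: riemann_zeta_eq_zeta_ext zeta_ext_holomorphic)

text \<open>The identity theorem carries the equation from Re s < 0 to a domain that contains the
  critical line; at s = 0 the argument 1 - s would meet the pole.\<close>

lemma riemann_zeta_functional:
  assumes "Re s < 1" "s \<noteq> 0"
  shows "riemann_zeta s = zeta_chi s * riemann_zeta (1 - s)"
proof (rule analytic_continuation_open[where z = s and f = riemann_zeta and
      g = "\<lambda>s. zeta_chi s * riemann_zeta (1 - s)" and s = "{s. Re s < 0}" and s' = "{s. Re s < 1} - {0}"])
  have "(- 1::complex) \<in> {s. Re s < 0}" by simp
  thus "{s. Re s < 0} \<noteq> ({} :: complex set)" by blast
  show "connected ({s. Re s < 1} - {0})"
    by (intro connected_open_delete convex_connected open_halfspace_Re_lt convex_halfspace_Re_lt) simp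
  show "open ({s. Re s < 1} - {0})" by (intro open_Diff open_halfspace_Re_lt) auto
  show "riemann_zeta holomorphic_on {s. Re s < 1} - {0}"
    by (rule holomorphic_on_subset[OF riemann_zeta_holomorphic]) auto
  show "(\<lambda>s. zeta_chi s * riemann_zeta (1 - s)) holomorphic_on {s. Re s < 1} - {0}"
    by (intro holomorphic_intros holomorphic_on_compose_gen[OF _ riemann_zeta_holomorphic, unfolded o_def]
           holomorphic_on_subset[OF zeta_chi_holomorphic]) auto
  show "riemann_zeta s = zeta_chi s * riemann_zeta (1 - s)" if "s \<in> {s. Re s < 0}" for s
    using that by (simp add: riemann_zeta_eq_zeta_ext zeta_ext_left) (auto simp: zeta_ext_def)
qed (use assms in \<open>auto simp: open_halfspace_Re_lt\<close>)

text \<open>The Dirichlet series has real coefficients, so s -> cnj(zeta(cnj s)) continues the same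
  series.\<close>

lemma riemann_zeta_cnj: "riemann_zeta (cnj s) = cnj (riemann_zeta s)"
proof -
  have "(\<lambda>s. cnj (riemann_zeta (cnj s))) = riemann_zeta"
  proof (rule zeta_continuation_unique)
    have "cnj \<circ> riemann_zeta \<circ> cnj holomorphic_on - {1}"
    proof (rule holomorphic_on_compose_cnj_cnj)
      have "cnj ` (- {1}) = - {1}"
      proof safe
        fix x :: complex assume "x \<notin> cnj ` (- {1})" thus "x = 1"
          by (metis ComplI complex_cnj_cnj complex_cnj_one image_eqI singletonD)
      qed (metis complex_cnj_cnj complex_cnj_one)
      thus "riemann_zeta holomorphic_on cnj ` (- {1})" by (simp add: riemann_zeta_holomorphic)
    qed auto
    thus "(\<lambda>s. cnj (riemann_zeta (cnj s))) holomorphic_on - {1}" by (simp add: o_def)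
    show "cnj (riemann_zeta (cnj s)) = riemann_zeta s" if "Re s > 1" for s
    proof -
      have "Re (cnj s) > 1" using that by simp
      from sums_cnj[THEN iffD2, OF zeta_ext_sums[OF this]]
      have "(\<lambda>n. cnj (1 / of_nat (Suc n) powr cnj s)) sums cnj (zeta_ext (cnj s))" .
      moreover have "cnj (1 / of_nat (Suc n) powr cnj s) = 1 / of_nat (Suc n) powr s" for n
        by (subst complex_cnj_divide, subst cnj_powr) (auto simp: complex_nonpos_Reals_iff simp del: of_nat_Suc)
      ultimately show ?thesis using zeta_ext_sums[OF that] sums_unique2
        by (simp add: riemann_zeta_eq_zeta_ext) blast
    qed
  qed (simp_all add: riemann_zeta_holomorphic, simp add: riemann_zeta_eq_zeta_ext zeta_ext_def)
  hence "cnj (riemann_zeta (cnj s)) = riemann_zeta s" by (rule fun_cong)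
  thus ?thesis by (metis complex_cnj_cnj)
qed

section \<open>The logarithmic derivative on the critical line\<close>

text \<open>The bracket is chi'/chi, collected from the power, the sine and the Gamma factor in
  turn.\<close>

lemma has_field_derivative_zeta_chi:
  assumes "Re s < 1" "sin (of_real pi * s / 2) \<noteq> 0"
  shows "(zeta_chi has_field_derivative zeta_chi s *
     (of_real (ln (2 * pi)) + of_real (pi / 2) * (cos (of_real pi * s / 2) / sin (of_real pi * s / 2)) - Digamma (1 - s))) (at s)"
proof -
  have ns: "1 - s \<notin> \<int>\<^sub>\<le>\<^sub>0"
    using assms(1) by (auto elim!: nonpos_Ints_cases dest!: arg_cong[of _ _ Re])
  have l: "Ln (2 * complex_of_real pi) = of_real (ln (2 * pi))"
    using Ln_of_real[of "2 * pi"] by simp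
  have d1: "((\<lambda>s. (2 * of_real pi) powr (s - 1)) has_field_derivative
      of_real (ln (2 * pi)) * (2 * of_real pi) powr (s - 1)) (at s)"
    unfolding l [symmetric] by (auto intro!: derivative_eq_intros simp: powr_def)
  have d2: "((\<lambda>s. sin (of_real pi * s / 2)) has_field_derivative cos (of_real pi * s / 2) * (of_real pi / 2)) (at s)"
    by (auto intro!: derivative_eq_intros)
  have d3: "((\<lambda>s. Gamma (1 - s)) has_field_derivative - (Gamma (1 - s) * Digamma (1 - s))) (at s)"
    using ns by (auto intro!: derivative_eq_intros)
  define P A B where "P = (2 * complex_of_real pi) powr (s - 1)" and "A = sin (of_real pi * s / 2)"
    and "B = cos (of_real pi * s / 2)"
  have "(zeta_chi has_field_derivative (2 * (of_real (ln (2 * pi)) * P) * A + B * (of_real pi / 2) * (2 * P)) * Gamma (1 - s)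
     + - (Gamma (1 - s) * Digamma (1 - s)) * (2 * P * A)) (at s)"
    unfolding zeta_chi_def P_def A_def B_def by (intro DERIV_mult DERIV_cmult d1 d2 d3)
  also have "(2 * (of_real (ln (2 * pi)) * P) * A + B * (of_real pi / 2) * (2 * P)) * Gamma (1 - s)
     + - (Gamma (1 - s) * Digamma (1 - s)) * (2 * P * A) =
      zeta_chi s * (of_real (ln (2 * pi)) + of_real (pi / 2) * (B / A) - Digamma (1 - s))"
    using assms(2) unfolding zeta_chi_def P_def [symmetric] A_def [symmetric] by (simp add: field_simps)
  finally show ?thesis by (simp add: A_def B_def)
qed

text \<open>Since 2w = pi/2 + i pi \<rho>, the sine of 2w is cosh(pi \<rho>), which is nonzero, and
  cot w = (1 + cos 2w) / sin 2w, where cos 2w is purely imaginary.\<close>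

lemma sin_cot_crit:
  fixes \<rho> :: real
  defines "w \<equiv> of_real pi * crit \<rho> / 2"
  shows "sin w \<noteq> 0" and "Re (cos w / sin w) = 1 / cosh (pi * \<rho>)"
proof -
  have cw: "cos w = cnj (sin w)"
  proof -
    have "cnj w = of_real pi / 2 - w" by (simp add: w_def crit_def field_simps)
    thus ?thesis by (simp add: cnj_sin sin_diff)
  qed
  have ch: "cos (\<i> * of_real (pi * \<rho>)) = of_real (cosh (pi * \<rho>))"
           "sin (\<i> * of_real (pi * \<rho>)) = \<i> * of_real (sinh (pi * \<rho>))"
    by (simp_all add: cos_exp_eq sin_exp_eq cosh_field_def sinh_field_def exp_of_real [symmetric] field_simps)
  have w2: "2 * w = of_real pi / 2 + \<i> * of_real (pi * \<rho>)"
    by (simp add: w_def crit_def field_simps)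
  have "sin (2 * w) = of_real (cosh (pi * \<rho>))" "cos (2 * w) = - \<i> * of_real (sinh (pi * \<rho>))"
    unfolding w2 sin_add cos_add ch by simp_all
  hence s2: "2 * (sin w * cos w) = of_real (cosh (pi * \<rho>))" and c2: "2 * (cos w)\<^sup>2 - 1 = - \<i> * of_real (sinh (pi * \<rho>))"
    by (simp_all add: sin_double cos_double_cos mult.assoc)
  from s2 show nz: "sin w \<noteq> 0" by auto
  have "cos w / sin w = (2 * (cos w)\<^sup>2) / (2 * (sin w * cos w))"
    using nz cw by (simp add: power2_eq_square)
  also have "\<dots> = (1 - \<i> * of_real (sinh (pi * \<rho>))) / of_real (cosh (pi * \<rho>))"
    unfolding s2 using c2 by (simp add: algebra_simps)
  finally show "Re (cos w / sin w) = 1 / cosh (pi * \<rho>)" by simp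
qed

lemma cnj_Digamma:
  assumes "z \<noteq> 0"
  shows "cnj (Digamma z) = Digamma (cnj z)"
proof -
  have S: "(\<lambda>k. inverse (of_nat (Suc k)) - inverse (w + of_nat k)) sums (Digamma w + euler_mascheroni)"
    if "w \<noteq> 0" for w :: complex
    unfolding Digamma_def diff_add_cancel by (intro summable_sums summable_Digamma that)
  have "(\<lambda>k. inverse (of_nat (Suc k)) - inverse (cnj z + of_nat k)) sums cnj (Digamma z + euler_mascheroni)"
    using sums_cnj[THEN iffD2, OF S[OF assms]] by simp
  moreover have "(\<lambda>k. inverse (of_nat (Suc k)) - inverse (cnj z + of_nat k)) sums (Digamma (cnj z) + euler_mascheroni)"
    using assms by (intro S) simp
  ultimately have "cnj (Digamma z + euler_mascheroni) = Digamma (cnj z) + euler_mascheroni"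
    by (rule sums_unique2)
  moreover have "cnj (euler_mascheroni :: complex) = euler_mascheroni"
    by (metis complex_cnj_complex_of_real of_real_euler_mascheroni)
  ultimately show ?thesis by simp
qed

lemma deriv_riemann_zeta:
  "s \<noteq> 1 \<Longrightarrow> (riemann_zeta has_field_derivative deriv riemann_zeta s) (at s)"
  by (rule holomorphic_derivI[OF riemann_zeta_holomorphic]) auto

lemma deriv_riemann_zeta_cnj:
  assumes "s \<noteq> 1"
  shows "deriv riemann_zeta (cnj s) = cnj (deriv riemann_zeta s)"
proof (rule DERIV_imp_deriv)
  have "(cnj \<circ> riemann_zeta \<circ> cnj has_field_derivative cnj (deriv riemann_zeta s)) (at (cnj s))"
    using has_field_derivative_cnj_cnj[of riemann_zeta "deriv riemann_zeta s" "cnj s"] deriv_riemann_zeta[OF assms]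
    by simp
  also have "cnj \<circ> riemann_zeta \<circ> cnj = riemann_zeta"
    by (simp add: fun_eq_iff riemann_zeta_cnj)
  finally show "(riemann_zeta has_field_derivative cnj (deriv riemann_zeta s)) (at (cnj s))" .
qed

lemma crit_facts: "crit \<rho> \<noteq> 1" "crit \<rho> \<noteq> 0" "Re (crit \<rho>) = 1 / 2" "Im (crit \<rho>) = \<rho>" "1 - crit \<rho> = cnj (crit \<rho>)"
  by (auto simp: crit_def complex_eq_iff)

text \<open>The differentiated functional equation at a point where 1 - s = cnj s. Stated with
  products and with \<open>f_recip\<close>, it also holds at zeros of zeta and of the denominator of
  f.\<close>

lemma riemann_zeta_crit_log_derivative:
  "Re (deriv riemann_zeta (crit \<rho>) * cnj (riemann_zeta (crit \<rho>))) = f_recip \<rho> * (norm (riemann_zeta (crit \<rho>)))\<^sup>2"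
proof -
  define s where "s = crit \<rho>"
  define Z D where "Z = riemann_zeta s" and "D = deriv riemann_zeta s"
  define w where "w = of_real pi * s / 2"
  define L where "L = of_real (ln (2 * pi)) + of_real (pi / 2) * (cos w / sin w) - Digamma (1 - s)"
  have s: "s \<noteq> 1" "s \<noteq> 0" "Re s = 1 / 2" "1 - s = cnj s" using crit_facts by (auto simp: s_def)
  have dchi: "(zeta_chi has_field_derivative zeta_chi s * L) (at s)"
    unfolding L_def w_def using s sin_cot_crit(1)[of \<rho>]
    by (intro has_field_derivative_zeta_chi) (auto simp: s_def)
  have d1: "((\<lambda>s. riemann_zeta (1 - s)) has_field_derivative - deriv riemann_zeta (1 - s)) (at s)"
  proof -
    have "((\<lambda>s. 1 - s) has_field_derivative - 1) (at s)"
      by (auto intro!: derivative_eq_intros)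
    moreover have "1 - s \<noteq> 1" using s(2) by simp
    ultimately show ?thesis
      using DERIV_chain2[OF deriv_riemann_zeta, of "\<lambda>s. 1 - s" s "- 1" UNIV] by simp
  qed
  have "((\<lambda>s. zeta_chi s * riemann_zeta (1 - s)) has_field_derivative
      zeta_chi s * L * riemann_zeta (1 - s) + - deriv riemann_zeta (1 - s) * zeta_chi s) (at s)"
    by (intro DERIV_mult dchi d1)
  hence "(riemann_zeta has_field_derivative
      zeta_chi s * L * riemann_zeta (1 - s) + - deriv riemann_zeta (1 - s) * zeta_chi s) (at s)"
  proof (rule has_field_derivative_transform_within_open)
    show "open ({s. Re s < 1} - {0})" by (intro open_Diff open_halfspace_Re_lt) auto
  qed (use s in \<open>auto simp: riemann_zeta_functional [symmetric]\<close>)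
  hence "D = zeta_chi s * L * riemann_zeta (1 - s) + - deriv riemann_zeta (1 - s) * zeta_chi s"
    unfolding D_def by (rule DERIV_imp_deriv)
  hence D: "D = zeta_chi s * L * cnj Z - cnj D * zeta_chi s"
    using s by (simp add: riemann_zeta_cnj deriv_riemann_zeta_cnj Z_def D_def)
  have Z: "Z = zeta_chi s * cnj Z"
    using riemann_zeta_functional[of s] s by (simp add: riemann_zeta_cnj Z_def)
  \<comment> \<open>After multiplication by \<open>cnj Z\<close>, chi occurs only in
    \<open>zeta_chi s * cnj Z\<close>, which equals \<open>Z\<close>.\<close>
  have "D * cnj Z = (zeta_chi s * cnj Z) * L * cnj Z - cnj D * (zeta_chi s * cnj Z)"
    by (subst D) (simp add: algebra_simps)
  hence "D * cnj Z + cnj (D * cnj Z) = L * (Z * cnj Z)"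
    unfolding Z [symmetric] by (simp add: algebra_simps)
  hence "of_real (2 * Re (D * cnj Z)) = L * of_real ((norm Z)\<^sup>2)"
    by (simp only: complex_add_cnj complex_norm_square)
  hence "Re (of_real (2 * Re (D * cnj Z))) = Re (L * of_real ((norm Z)\<^sup>2))" by (rule arg_cong)
  hence E: "2 * Re (D * cnj Z) = Re L * (norm Z)\<^sup>2"
    by simp
  have "Digamma (1 - s) = cnj (Digamma s)" unfolding s(4) by (rule cnj_Digamma[OF s(2), symmetric])
  hence "Re L = ln (2 * pi) + pi / 2 * (1 / cosh (pi * \<rho>)) - Re (Digamma s)"
    unfolding L_def minus_complex.simps plus_complex.simps times_complex.simps
      Re_complex_of_real Im_complex_of_real
    using sin_cot_crit(2)[of \<rho>] by (simp add: w_def s_def)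
  also have "\<dots> = 2 * f_recip \<rho>"
    by (simp add: f_recip_def f_denom_def s_def field_simps)
  finally show ?thesis using E by (simp add: s_def Z_def D_def)
qed

section \<open>Uniqueness of the zero of the denominator of f\<close>

text \<open>The comparison is termwise: with c = k + 1/2, the subtracted term of the digamma series
  has real part c/(c^2 + \<rho>^2), which decreases strictly in \<rho> \<ge> 0.\<close>

lemma Re_Digamma_crit_strict_mono:
  assumes "0 \<le> a" "a < b"
  shows "Re (Digamma (crit a)) < Re (Digamma (crit b))"
proof -
  define t where "t = (\<lambda>\<rho> k. inverse (real (Suc k)) - (real k + 1/2) / ((real k + 1/2)\<^sup>2 + \<rho>\<^sup>2))"
  have t: "t \<rho> sums (Re (Digamma (crit \<rho>)) + euler_mascheroni)" for \<rho>
  proof -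
    have "(\<lambda>k. inverse (of_nat (Suc k)) - inverse (crit \<rho> + of_nat k)) sums (Digamma (crit \<rho>) + euler_mascheroni)"
      unfolding Digamma_def diff_add_cancel by (intro summable_sums summable_Digamma crit_facts)
    hence "(\<lambda>k. Re (inverse (of_nat (Suc k)) - inverse (crit \<rho> + of_nat k))) sums Re (Digamma (crit \<rho>) + euler_mascheroni)"
      by (rule sums_Re)
    moreover have "Re (inverse (of_nat (Suc k)) - inverse (crit \<rho> + of_nat k)) = t \<rho> k" for k
    proof -
      have "inverse (complex_of_nat (Suc k)) = of_real (inverse (real (Suc k)))" by simp
      hence "Re (inverse (complex_of_nat (Suc k))) = inverse (real (Suc k))" by (simp only: Re_complex_of_real)
      thus ?thesis by (simp add: t_def crit_facts add.commute del: of_nat_Suc)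
    qed
    moreover have "Re (euler_mascheroni :: complex) = euler_mascheroni"
      by (metis Re_complex_of_real of_real_euler_mascheroni)
    ultimately show ?thesis by simp
  qed
  have le: "t a k < t b k" for k
  proof -
    define c where "c = real k + 1 / 2"
    have "c > 0" by (simp add: c_def)
    moreover have "a\<^sup>2 < b\<^sup>2" using assms by (intro power_strict_mono) auto
    ultimately show ?thesis
      unfolding t_def c_def [symmetric]
      by (intro diff_strict_left_mono divide_strict_left_mono mult_pos_pos add_pos_nonneg) auto
  qed
  have "0 < (\<Sum>k. t b k - t a k)"
    using sums_summable[OF t] le by (intro suminf_pos summable_diff) auto
  also have "\<dots> = Re (Digamma (crit b)) - Re (Digamma (crit a))"
    using sums_diff[OF t t, of b a] by (simp add: sums_iff)
  finally show ?thesis by simp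
qed

text \<open>At a zero, Re psi equals ln(2 pi) + pi/(2 cosh(pi \<rho>)); the former increases
  strictly and the latter is nonincreasing, so there is at most one zero on [0, infinity). The given
  zero supplies existence for the \<open>THE\<close>, once it is known to be positive.\<close>

lemma f_denom_eq_0_imp_rho_s:
  assumes "\<rho> \<ge> 0" "f_denom \<rho> = 0"
  shows "\<rho> = rho_s"
proof -
  have fz: "Re (Digamma (crit \<rho>)) = ln (2 * pi) + pi / 2 / cosh (pi * \<rho>)" if "f_denom \<rho> = 0" for \<rho>
    using that by (simp add: f_denom_def field_simps)
  have uniq: False if "0 \<le> a" "a < b" "f_denom a = 0" "f_denom b = 0" for a b
  proof -
    have "cosh (pi * a) \<le> cosh (pi * b)" using that by (subst cosh_real_nonneg_le_iff) auto
    hence "pi / 2 / cosh (pi * b) \<le> pi / 2 / cosh (pi * a)" by (intro divide_left_mono) auto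
    thus False using Re_Digamma_crit_strict_mono[OF that(1,2)] fz[OF that(3)] fz[OF that(4)] by linarith
  qed
  \<comment> \<open>psi(1/2) = -gamma - 2 ln 2 is negative, so every summand is positive at
    0.\<close>
  have "f_denom 0 > 0"
  proof -
    have "Re (Digamma (crit 0)) < 0"
    proof -
      have "crit 0 = 1 / 2" by (simp add: crit_def)
      moreover have "Digamma (1 / 2 :: complex) = of_real (- euler_mascheroni - 2 * ln 2)"
        by (simp add: Digamma_one_half)
      moreover have "- euler_mascheroni - 2 * ln 2 < (0 :: real)"
        using euler_mascheroni_pos ln_gt_zero[of 2] by linarith
      ultimately show ?thesis by (metis Re_complex_of_real)
    qed
    moreover have "ln (2 * pi) > 0" using pi_gt3 by simp
    ultimately have "2 * ln (2 * pi) - 2 * Re (Digamma (crit 0)) + pi > 0"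
      using pi_gt_zero by linarith
    thus ?thesis by (simp add: f_denom_def)
  qed
  with assms have pos: "\<rho> > 0" by (cases "\<rho> = 0") auto
  show ?thesis unfolding rho_s_def
  proof (rule the_equality[symmetric])
    fix x assume "x > 0 \<and> f_denom x = 0"
    thus "x = \<rho>" using uniq[of x \<rho>] uniq[of \<rho> x] assms pos by fastforce
  qed (use pos assms in auto)
qed

section \<open>Derivative of a continuous argument\<close>

text \<open>Near x, \<alpha> coincides with \<alpha>(x) + Im Ln(g(y)/g(x)). The quotient is 1 at y =
  x, away from the branch cut, so this expression can be differentiated.\<close>

lemma continuous_Arg_has_derivative:
  fixes g :: "real \<Rightarrow> complex" and \<alpha> :: "real \<Rightarrow> real"
  assumes g: "(g has_vector_derivative g') (at x within I)" and nz: "g x \<noteq> 0"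
    and \<alpha>: "continuous_on I \<alpha>" "\<And>y. y \<in> I \<Longrightarrow> is_Arg (g y) (\<alpha> y)" and x: "x \<in> I"
  shows "(\<alpha> has_real_derivative Im (g' / g x)) (at x within I)"
proof -
  define h where "h = (\<lambda>y. \<alpha> x + Im (Ln (g y / g x)))"
  have "((\<lambda>y. g y / g x) has_vector_derivative g' / g x) (at x within I)"
    using g by (rule has_vector_derivative_divide)
  moreover have "(Ln has_field_derivative 1) (at (g x / g x))"
    using nz by (auto intro!: derivative_eq_intros)
  ultimately have "(Ln \<circ> (\<lambda>y. g y / g x) has_vector_derivative g' / g x * 1) (at x within I)"
    by (rule field_vector_diff_chain_within[OF _ has_field_derivative_at_within])
  hence "((\<lambda>y. Im ((Ln \<circ> (\<lambda>y. g y / g x)) y)) has_vector_derivative Im (g' / g x * 1)) (at x within I)"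
    by (rule bounded_linear.has_vector_derivative[OF bounded_linear_Im])
  hence "((\<lambda>y. Im (Ln (g y / g x))) has_real_derivative Im (g' / g x)) (at x within I)"
    by (simp add: has_real_derivative_iff_has_vector_derivative)
  hence h: "(h has_real_derivative Im (g' / g x)) (at x within I)"
    unfolding h_def using DERIV_add[OF DERIV_const, of "\<lambda>y. Im (Ln (g y / g x))" _ x I "\<alpha> x"] by simp
  have "continuous (at x within I) \<alpha>"
    using \<alpha>(1) x by (simp add: continuous_on_eq_continuous_within)
  moreover have "continuous (at x within I) g"
    using g has_vector_derivative_continuous by blast
  \<comment> \<open>The first bound places \<alpha>(y) - \<alpha>(x) within the range of the
    principal logarithm; the second keeps g(y) away from 0.\<close>
  ultimately have ev: "\<forall>\<^sub>F y in at x within I. dist (\<alpha> y) (\<alpha> x) < pi \<and> dist (g y) (g x) < norm (g x)"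
    using nz unfolding continuous_within by (intro eventually_conj tendstoD) auto
  moreover have "\<forall>\<^sub>F y in at x within I. y \<in> I" by (simp add: eventually_at_filter)
  ultimately have "\<forall>\<^sub>F y in at x within I. h y = \<alpha> y"
  proof eventually_elim
    case (elim y)
    define r where "r = norm (g y) / norm (g x)"
    have "g y \<noteq> 0" using elim by auto
    hence r: "r > 0" using nz by (simp add: r_def)
    have "g y / g x = of_real r * (exp (\<i> * of_real (\<alpha> y)) / exp (\<i> * of_real (\<alpha> x)))"
      using \<alpha>(2)[of y] \<alpha>(2)[OF x] elim unfolding is_Arg_def r_def
      by (metis of_real_divide times_divide_times_eq)
    also have "\<dots> = exp (of_real (ln r) + \<i> * of_real (\<alpha> y - \<alpha> x))"
      using r by (simp add: exp_add exp_diff right_diff_distrib exp_of_real)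
    finally have "Ln (g y / g x) = of_real (ln r) + \<i> * of_real (\<alpha> y - \<alpha> x)"
      using elim by (simp add: Ln_exp dist_real_def abs_less_iff)
    thus ?case by (simp add: h_def)
  qed
  moreover have "h x = \<alpha> x" using nz by (simp add: h_def)
  ultimately show ?thesis using h
    by (subst (asm) has_field_derivative_cong_eventually)
qed


theorem mainTheorem3:
  shows "(\<forall>\<rho>::real. \<rho> \<ge> 0 \<and> \<rho> \<noteq> rho_s \<longrightarrow>
            (cmod (riemann_zeta (crit \<rho>)))\<^sup>2 = (zeta_I \<rho>)\<^sup>2 + (zeta_R \<rho>)\<^sup>2 \<and>
            (zeta_I \<rho>)\<^sup>2 + (zeta_R \<rho>)\<^sup>2
              = (zeta'_I \<rho> * zeta_I \<rho> + zeta'_R \<rho> * zeta_R \<rho>) * f_rho \<rho>)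
       \<and> (\<forall>(I::real set) (\<alpha>::real \<Rightarrow> real).
            is_interval I \<and> I \<subseteq> {0..} \<and>
            (\<forall>\<rho>\<in>I. riemann_zeta (crit \<rho>) \<noteq> 0) \<and>
            continuous_on I \<alpha> \<and>
            (\<forall>\<rho>\<in>I. is_Arg (riemann_zeta (crit \<rho>)) (\<alpha> \<rho>))
            \<longrightarrow> (\<forall>\<rho>\<in>I. (\<alpha> has_real_derivative f_recip \<rho>) (at \<rho> within I)))"
proof (intro conjI allI impI ballI)
  fix \<rho> :: real assume \<rho>: "\<rho> \<ge> 0 \<and> \<rho> \<noteq> rho_s"
  show nrm: "(cmod (riemann_zeta (crit \<rho>)))\<^sup>2 = (zeta_I \<rho>)\<^sup>2 + (zeta_R \<rho>)\<^sup>2"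
    by (simp add: cmod_power2 zeta_I_def zeta_R_def)
  \<comment> \<open>Here \<rho> \<noteq> \<open>rho_s\<close> enters: \<open>f_rho\<close> is then a
    genuine inverse of \<open>f_recip\<close>.\<close>
  have nz: "f_denom \<rho> \<noteq> 0" using f_denom_eq_0_imp_rho_s \<rho> by blast
  hence "f_recip \<rho> * f_rho \<rho> = 1" by (simp add: f_recip_def f_rho_def)
  moreover have "zeta'_I \<rho> * zeta_I \<rho> + zeta'_R \<rho> * zeta_R \<rho> = f_recip \<rho> * ((zeta_I \<rho>)\<^sup>2 + (zeta_R \<rho>)\<^sup>2)"
    using riemann_zeta_crit_log_derivative[of \<rho>] unfolding nrm
    by (simp add: zeta'_I_def zeta'_R_def zeta_I_def zeta_R_def)
  ultimately show "(zeta_I \<rho>)\<^sup>2 + (zeta_R \<rho>)\<^sup>2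
              = (zeta'_I \<rho> * zeta_I \<rho> + zeta'_R \<rho> * zeta_R \<rho>) * f_rho \<rho>"
    by (simp add: mult_ac)
next
  fix I :: "real set" and \<alpha> :: "real \<Rightarrow> real" and \<rho>
  assume I: "is_interval I \<and> I \<subseteq> {0..} \<and> (\<forall>\<rho>\<in>I. riemann_zeta (crit \<rho>) \<noteq> 0) \<and>
            continuous_on I \<alpha> \<and> (\<forall>\<rho>\<in>I. is_Arg (riemann_zeta (crit \<rho>)) (\<alpha> \<rho>))"
    and "\<rho> \<in> I"
  let ?Z = "riemann_zeta (crit \<rho>)" and ?D = "deriv riemann_zeta (crit \<rho>)"
  have nz: "?Z \<noteq> 0" using I \<open>\<rho> \<in> I\<close> by blast
  have "(crit has_vector_derivative \<i>) (at \<rho> within I)"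
    unfolding crit_def by (auto intro!: derivative_eq_intros)
  hence "(riemann_zeta \<circ> crit has_vector_derivative \<i> * ?D) (at \<rho> within I)"
    by (rule field_vector_diff_chain_within)
       (rule has_field_derivative_at_within[OF deriv_riemann_zeta[OF crit_facts(1)]])
  hence "((\<lambda>y. riemann_zeta (crit y)) has_vector_derivative \<i> * ?D) (at \<rho> within I)"
    by (simp add: o_def)
  hence "(\<alpha> has_real_derivative Im (\<i> * ?D / ?Z)) (at \<rho> within I)"
    by (rule continuous_Arg_has_derivative) (use I \<open>\<rho> \<in> I\<close> in auto)
  \<comment> \<open>Expanding the fraction by \<open>cnj ?Z\<close> gives Re(D cnj Z)/|Z|^2, to
    which the logarithmic derivative identity applies.\<close>
  moreover have "Im (\<i> * ?D / ?Z) = f_recip \<rho>"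
  proof -
    have "\<i> * ?D / ?Z = \<i> * (?D * cnj ?Z) / of_real ((norm ?Z)\<^sup>2)"
      using nz unfolding complex_norm_square by (simp add: field_simps)
    hence "Im (\<i> * ?D / ?Z) = Re (?D * cnj ?Z) / (norm ?Z)\<^sup>2"
      by (simp only: Im_divide_of_real Im_i_times)
    thus ?thesis using nz unfolding riemann_zeta_crit_log_derivative by simp
  qed
  ultimately show "(\<alpha> has_real_derivative f_recip \<rho>) (at \<rho> within I)" by simp
qed

end
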